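(* Let $G$ be a group and $H$ a hyperbolically embedded subgroup of $G$. Then $H$ is undistorted in $G$ with respect to the stable commutator length; that is, there exists a constant $B$ such that for every $h\in[H,H]$ we have $scl_H(h)\le B\, scl_G(h)$.
   Context: For a group $G$ and $g\in[G,G]$, the commutator length $cl_G(g)$ is the minimal number of commutators whose product equals $g$ in $G$, and $scl_G(g)=\lim_{n\to\infty}cl_G(g^n)/n$. Hyperbolically embedded subgroups: let $H\le G$ and $X\subseteq G$ with $G=\langle X\cup H\rangle$. Let $\Gamma(G,X\sqcup (H\setminus\{1\}))$ be the Cayley graph of $G$ with edges labeled by letters of the disjoint union $X\sqcup (H\setminus\{1\})$ (letters representing the same element give multiple edges). The complete graph $\Gamma(H,H\setminus\{1\})$ is viewed as a subgraph. For $h,k\in H$ let $\widehat d(h,k)\in[0,+\infty]$ be the length of a shortest path in $\Gamma(G,X\sqcup (H\setminus\{1\}))$ from $h$ to $k$ having no edges in $\Gamma(H,H\setminus\{1\})$ ($=\infty$ if none exists). $H$ is hyperbolically embedded in $G$ with respect to $X$ if (a) $G=\langle X\cup H\rangle$ and $\Gamma(G,X\sqcup (H\setminus\{1\}))$ is Gromov hyperbolic, and (b) $(H,\widehat d)$ is locally finite, i.e. every ball of finite radius contains finitely many elements. $H$ is hyperbolically embedded in $G$ if this holds for some (not necessarily finite) $X\subseteq G$. *)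

theory Defs
  imports
    "HOL-Analysis.Analysis"
    "HOL-Algebra.Generated_Groups"
    "Graph_Theory.Arc_Walk"
begin

section \<open>Commutator length\<close>

text \<open>
  \<open>derived_set G (carrier G)\<close> is the set of commutators of \<open>G\<close>.  The identity is the empty
  product, so it has commutator length 0.  Both notions are meant for elements of
  \<open>derived G (carrier G)\<close>; there the set under \<open>LEAST\<close> is inhabited and the limit exists by
  subadditivity.
\<close>

definition cl :: "('a, 'b) monoid_scheme \<Rightarrow> 'a \<Rightarrow> nat" where
  "cl G g = (LEAST n. \<exists>cs. length cs = n \<and> set cs \<subseteq> derived_set G (carrier G)
                        \<and> foldr (\<otimes>\<^bsub>G\<^esub>) cs \<one>\<^bsub>G\<^esub> = g)"

definition scl :: "('a, 'b) monoid_scheme \<Rightarrow> 'a \<Rightarrow> real" where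
  "scl G g = lim (\<lambda>n. real (cl G (g [^]\<^bsub>G\<^esub> n)) / real n)"


section \<open>Graphs as metric spaces\<close>

text \<open>
  A \<open>pre_digraph\<close> is read here as an undirected multigraph: paths may traverse an arc in either
  direction, so they are the directed walks of the graph in which every arc is doubled by its
  reverse (flag \<open>False\<close>).
\<close>

definition bidirect :: "('v, 'e) pre_digraph \<Rightarrow> ('v, 'e \<times> bool) pre_digraph" where
  "bidirect \<Gamma> = \<lparr> verts = verts \<Gamma>,
                  arcs = arcs \<Gamma> \<times> UNIV,
                  tail = (\<lambda>(e, b). if b then tail \<Gamma> e else head \<Gamma> e),
                  head = (\<lambda>(e, b). if b then head \<Gamma> e else tail \<Gamma> e) \<rparr>"

text \<open>The infimum of the empty set is \<open>\<infinity>\<close>.\<close>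

definition graph_dist :: "('v, 'e) pre_digraph \<Rightarrow> 'v \<Rightarrow> 'v \<Rightarrow> ereal" where
  "graph_dist \<Gamma> u v = (INF p \<in> {p. pre_digraph.awalk (bidirect \<Gamma>) u p v}. ereal (real (length p)))"

text \<open>
  The geometric realization of a connected graph: \<open>(e, s)\<close> is the point at distance \<open>s\<close> from the
  tail of \<open>e\<close> on a unit segment representing \<open>e\<close>.  A vertex is represented once for each arc
  incident with it, so the path metric below is only a pseudometric on these representatives;
  points at distance 0 are the same point of the realization.  (A connected graph without
  arcs has a single vertex; its realization is a point and the representation is empty,
  which makes no difference for hyperbolicity.)
\<close>

definition realization_points :: "('v, 'e) pre_digraph \<Rightarrow> ('e \<times> real) set" where
  "realization_points \<Gamma> = arcs \<Gamma> \<times> {0..1}"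

definition realization_dist :: "('v, 'e) pre_digraph \<Rightarrow> 'e \<times> real \<Rightarrow> 'e \<times> real \<Rightarrow> real" where
  "realization_dist \<Gamma> = (\<lambda>(e, s) (f, t).
     let d = (\<lambda>u v. real_of_ereal (graph_dist \<Gamma> u v));
         through_vertices =
           {s + d (tail \<Gamma> e) (tail \<Gamma> f) + t,
            s + d (tail \<Gamma> e) (head \<Gamma> f) + (1 - t),
            (1 - s) + d (head \<Gamma> e) (tail \<Gamma> f) + t,
            (1 - s) + d (head \<Gamma> e) (head \<Gamma> f) + (1 - t)};
         along_edge = (if e = f then {\<bar>s - t\<bar>} else {})
     in Min (through_vertices \<union> along_edge))"

definition gromov_product :: "('p \<Rightarrow> 'p \<Rightarrow> real) \<Rightarrow> 'p \<Rightarrow> 'p \<Rightarrow> 'p \<Rightarrow> real" where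
  "gromov_product d w x y = (d x w + d y w - d x y) / 2"

definition gromov_hyperbolic :: "'p set \<Rightarrow> ('p \<Rightarrow> 'p \<Rightarrow> real) \<Rightarrow> bool" where
  "gromov_hyperbolic M d \<longleftrightarrow>
     (\<exists>\<delta>\<ge>0. \<forall>x\<in>M. \<forall>y\<in>M. \<forall>z\<in>M. \<forall>w\<in>M.
        gromov_product d w x z \<ge> min (gromov_product d w x y) (gromov_product d w y z) - \<delta>)"

text \<open>Meaningful for connected graphs only, where all values of \<open>graph_dist\<close> are finite.\<close>

definition hyperbolic_graph :: "('v, 'e) pre_digraph \<Rightarrow> bool" where
  "hyperbolic_graph \<Gamma> \<longleftrightarrow> gromov_hyperbolic (realization_points \<Gamma>) (realization_dist \<Gamma>)"


section \<open>Hyperbolically embedded subgroups\<close>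

text \<open>
  Letters of the disjoint union of \<open>X\<close> and \<open>H - {1}\<close> are elements of a sum type; \<open>letter\<close> maps
  a letter to the group element it represents.  The arc \<open>(g, a)\<close> is the edge labelled \<open>a\<close> from
  \<open>g\<close> to \<open>g \<cdot> letter a\<close>.
\<close>

definition letter :: "'a + 'a \<Rightarrow> 'a" where
  "letter = case_sum (\<lambda>x. x) (\<lambda>h. h)"

definition cayley_graph ::
  "('a, 'b) monoid_scheme \<Rightarrow> ('a + 'a) set \<Rightarrow> ('a, 'a \<times> ('a + 'a)) pre_digraph" where
  "cayley_graph G A = \<lparr> verts = carrier G,
                        arcs = carrier G \<times> A,
                        tail = fst,
                        head = (\<lambda>(g, a). g \<otimes>\<^bsub>G\<^esub> letter a) \<rparr>"

definition relative_cayley_graph ::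
  "('a, 'b) monoid_scheme \<Rightarrow> 'a set \<Rightarrow> 'a set \<Rightarrow> ('a, 'a \<times> ('a + 'a)) pre_digraph" where
  "relative_cayley_graph G H X = cayley_graph G (X <+> (H - {\<one>\<^bsub>G\<^esub>}))"

text \<open>
  Only the edges of the Cayley graph of \<open>H\<close> are removed: an edge between elements of \<open>H\<close> whose
  label is a letter from \<open>X\<close> is kept, even if that letter represents an element of \<open>H\<close>.
\<close>

definition relative_dist ::
  "('a, 'b) monoid_scheme \<Rightarrow> 'a set \<Rightarrow> 'a set \<Rightarrow> 'a \<Rightarrow> 'a \<Rightarrow> ereal" where
  "relative_dist G H X =
     (let \<Gamma> = relative_cayley_graph G H X;
          \<Gamma>\<^sub>H = cayley_graph (G\<lparr>carrier := H\<rparr>) ({} <+> (H - {\<one>\<^bsub>G\<^esub>}))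
      in graph_dist (\<Gamma>\<lparr>arcs := arcs \<Gamma> - arcs \<Gamma>\<^sub>H\<rparr>))"

definition hyperbolically_embedded_wrt ::
  "('a, 'b) monoid_scheme \<Rightarrow> 'a set \<Rightarrow> 'a set \<Rightarrow> bool" where
  "hyperbolically_embedded_wrt G H X \<longleftrightarrow>
     generate G (X \<union> H) = carrier G
     \<and> hyperbolic_graph (relative_cayley_graph G H X)
     \<and> (\<forall>h\<in>H. \<forall>r::real. finite {k \<in> H. relative_dist G H X h k \<le> ereal r})"

definition hyperbolically_embedded :: "('a, 'b) monoid_scheme \<Rightarrow> 'a set \<Rightarrow> bool" where
  "hyperbolically_embedded G H \<longleftrightarrow>
     subgroup H G \<and> (\<exists>X \<subseteq> carrier G. hyperbolically_embedded_wrt G H X)"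

end

theory Submission
  imports Defs "HOL-Library.Function_Algebras"
begin

text \<open>
  The known route extends quasimorphisms from \<open>H\<close> to \<open>G\<close> and concludes by Bavard duality.  The
  argument below is its predual: instead of pulling functions back, integral 1-chains on \<open>G\<close> are
  transferred to integral 1-chains on \<open>H\<close>.  The outcome is an inequality between unstabilized
  commutator lengths: there are \<open>k \<ge> 1\<close>, \<open>A\<close> and \<open>C\<close> with
  \<open>cl\<^sub>H (h\<^sup>k) \<le> A * cl\<^sub>G h + C\<close> for all \<open>h \<in> [H, H]\<close> (\<open>cl_power_bound\<close>).  Applied to the powers of
  \<open>h\<close>, it becomes \<open>scl\<^sub>H h \<le> A / k * scl\<^sub>G h\<close> in the limit (\<open>scl_bound\<close>).

  Algebra.  In the free abelian group on \<open>H\<close> a triangle is an element \<open>[x] + [y] - [x y]\<close>.  Let \<open>S\<close>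
  be a finite subset of \<open>H\<close> and suppose that, for some \<open>h \<in> [H, H]\<close>, the chain \<open>k [h]\<close> is a sum of
  \<open>m\<close> signed triangles and signed elements of \<open>S\<close>.  A triangle is the content of a word of value 1,
  and permuting the letters of a word costs a linear number of commutators; so \<open>h\<^sup>k\<close> is a product
  of \<open>O(m + k)\<close> commutators and of at most \<open>m\<close> elements of \<open>S\<close> or their inverses.  The product of
  the latter is in \<open>[H, H]\<close>, and Dickson's lemma bounds its commutator length linearly in \<open>m\<close>
  (\<open>filled_power\<close>).

  Transfer.  For a coset \<open>B\<close> of \<open>H\<close> and \<open>x \<in> G\<close> let \<open>proj B x\<close> be the set of points of \<open>B\<close> closest
  to \<open>x\<close> in the relative Cayley graph.  A pair \<open>(x, y)\<close> leaves at \<open>B\<close> the average of the chains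
  \<open>[p\<inverse> q] - [q\<inverse> p]\<close> over \<open>p \<in> proj B x\<close> and \<open>q \<in> proj B y\<close>, and the transfer of \<open>(x, y)\<close> is the sum
  of these over all cosets where the two projections are far apart.  Averaging makes the
  construction equivariant, and a factorial clears the denominators.  The transfers of the three
  sides of a triangle in \<open>G\<close> cancel at all but four cosets, and at each of these they add up to a
  bounded number of triangles and small elements of \<open>H\<close> (\<open>transfer_quasi_additive\<close>).  Therefore
  the chain that \<open>g \<in> G\<close> inherits from the pair \<open>(1, g)\<close> is filled by \<open>O(n)\<close> triangles and small
  elements if \<open>g\<close> is a product of \<open>n\<close> commutators of \<open>G\<close>; for \<open>h \<in> H\<close> it is a multiple of \<open>[h]\<close>,
  up to a bounded error (\<open>chain_H\<close>).

  Geometry.  Hyperbolicity enters only through one contraction property: if the projections of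
  \<open>x\<close> and \<open>y\<close> to \<open>B\<close> are far apart for the relative metric, then every geodesic from \<open>x\<close> to \<open>y\<close>
  runs along an edge of \<open>B\<close> (\<open>geodesic_through_coset\<close>).  It follows that only finitely many
  cosets contribute to a transfer, that \<open>B\<close> and another coset \<open>C\<close> cannot both separate the other
  one from a given point (\<open>behrstock\<close>), and that \<open>proj B y\<close> depends on \<open>C\<close> alone if \<open>C\<close> separates
  \<open>y\<close> from \<open>B\<close> (\<open>proj_eq_gate\<close>); the last fact is the source of the exact cancellation.
\<close>

section \<open>Products of commutators\<close>

context group
begin

abbreviation list_prod :: "'a list \<Rightarrow> 'a" where
  "list_prod xs \<equiv> foldr (\<otimes>) xs \<one>"

lemma list_prod_closed: "set xs \<subseteq> carrier G \<Longrightarrow> list_prod xs \<in> carrier G"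
  by (induction xs) auto

lemma list_prod_append:
  "set xs \<subseteq> carrier G \<Longrightarrow> set ys \<subseteq> carrier G \<Longrightarrow> list_prod (xs @ ys) = list_prod xs \<otimes> list_prod ys"
  by (induction xs) (auto simp: m_assoc list_prod_closed)

lemma list_prod_replicate: "x \<in> carrier G \<Longrightarrow> list_prod (replicate n x) = x [^] n"
proof (induction n)
  case (Suc n)
  then show ?case by (simp only: nat_pow_Suc2[OF Suc.prems] replicate_Suc foldr.simps o_def)
qed simp

definition commutators :: "'a set" where
  "commutators = derived_set G (carrier G)"

definition commutator_products :: "nat \<Rightarrow> 'a set" where
  "commutator_products n = {list_prod cs | cs. length cs \<le> n \<and> set cs \<subseteq> commutators}"

lemma commutatorI:
  "x \<in> carrier G \<Longrightarrow> y \<in> carrier G \<Longrightarrow> x \<otimes> y \<otimes> inv x \<otimes> inv y \<in> commutators"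
  unfolding commutators_def by blast

lemma commutatorE:
  assumes "c \<in> commutators"
  obtains x y where "x \<in> carrier G" "y \<in> carrier G" "c = x \<otimes> y \<otimes> inv x \<otimes> inv y"
  using assms unfolding commutators_def by blast

lemma commutators_closed: "commutators \<subseteq> carrier G"
  unfolding commutators_def by (simp add: derived_set_in_carrier)

lemma commutator_productsI:
  "length cs \<le> n \<Longrightarrow> set cs \<subseteq> commutators \<Longrightarrow> list_prod cs \<in> commutator_products n"
  unfolding commutator_products_def by blast

lemma commutator_productsE:
  assumes "x \<in> commutator_products n"
  obtains cs where "x = list_prod cs" "length cs \<le> n" "set cs \<subseteq> commutators"
  using assms unfolding commutator_products_def by blast

lemma commutator_products_mono: "m \<le> n \<Longrightarrow> commutator_products m \<subseteq> commutator_products n"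
  unfolding commutator_products_def by force

lemma one_commutator_products: "\<one> \<in> commutator_products n"
  using commutator_productsI[of "[]" n] by simp

lemma commutator_products_mult:
  assumes "x \<in> commutator_products m" and "y \<in> commutator_products n"
  shows "x \<otimes> y \<in> commutator_products (m + n)"
proof -
  obtain cs where cs: "x = list_prod cs" "length cs \<le> m" "set cs \<subseteq> commutators"
    using assms(1) by (rule commutator_productsE)
  obtain ds where ds: "y = list_prod ds" "length ds \<le> n" "set ds \<subseteq> commutators"
    using assms(2) by (rule commutator_productsE)
  have "x \<otimes> y = list_prod (cs @ ds)"
    unfolding cs(1) ds(1) using cs(3) ds(3) commutators_closed
    by (intro list_prod_append[symmetric]) blast+
  then show ?thesis
    using cs ds commutator_productsI[of "cs @ ds" "m + n"] by simp
qed

lemma commutators_subset_products: "commutators \<subseteq> commutator_products 1"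
proof
  fix c assume c: "c \<in> commutators"
  then have "c \<in> carrier G" using commutators_closed by blast
  then show "c \<in> commutator_products 1"
    using c commutator_productsI[of "[c]" 1] by simp
qed

lemma inv_commutator:
  assumes "c \<in> commutators"
  shows "inv c \<in> commutators"
proof -
  obtain x y where xy: "x \<in> carrier G" "y \<in> carrier G" "c = x \<otimes> y \<otimes> inv x \<otimes> inv y"
    using assms by (rule commutatorE)
  then have "inv c = y \<otimes> x \<otimes> inv y \<otimes> inv x"
    by (simp add: inv_mult_group m_assoc)
  then show ?thesis
    using xy commutatorI by simp
qed

lemma commutator_products_inv:
  assumes "x \<in> commutator_products n"
  shows "inv x \<in> commutator_products n"
proof -
  have *: "inv (list_prod cs) \<in> commutator_products (length cs)" if "set cs \<subseteq> commutators" for cs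
    using that
  proof (induction cs)
    case Nil
    then show ?case by (simp add: one_commutator_products)
  next
    case (Cons c cs)
    have c: "c \<in> commutators" and cs: "set cs \<subseteq> commutators"
      using Cons.prems by auto
    have "c \<in> carrier G" "list_prod cs \<in> carrier G"
      using c cs commutators_closed list_prod_closed[of cs] by auto
    then have "inv (list_prod (c # cs)) = inv (list_prod cs) \<otimes> inv c"
      by (simp add: inv_mult_group)
    moreover have "inv (list_prod cs) \<in> commutator_products (length cs)"
      using Cons.IH cs by blast
    moreover have "inv c \<in> commutator_products 1"
      using inv_commutator[OF c] commutators_subset_products by blast
    ultimately show ?case
      using commutator_products_mult[of "inv (list_prod cs)" "length cs" "inv c" 1] by simp
  qed
  obtain cs where cs: "x = list_prod cs" "length cs \<le> n" "set cs \<subseteq> commutators"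
    using assms by (rule commutator_productsE)
  then show ?thesis
    using *[of cs] commutator_products_mono[of "length cs" n] by blast
qed

text \<open>
  No inverses have to be added to the generators, because the inverse of the commutator of \<open>x\<close>
  and \<open>y\<close> is the commutator of \<open>y\<close> and \<open>x\<close>.
\<close>

lemma derived_eq_commutator_products:
  "derived G (carrier G) = (\<Union>n. commutator_products n)"
proof
  have "x \<in> (\<Union>n. commutator_products n)" if "x \<in> generate G commutators" for x
    using that
  proof (induction rule: generate.induct)
    case one
    then show ?case using one_commutator_products by blast
  next
    case (incl h)
    then show ?case using commutators_subset_products by blast
  next
    case (inv h)
    then show ?case using commutators_subset_products inv_commutator by blast
  next
    case (eng h1 h2)
    then show ?case using commutator_products_mult by blast
  qed
  then show "derived G (carrier G) \<subseteq> (\<Union>n. commutator_products n)"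
    unfolding derived_def commutators_def[symmetric] by blast
next
  interpret D: subgroup "derived G (carrier G)" G
    by (simp add: derived_is_subgroup)
  have "commutators \<subseteq> derived G (carrier G)"
    unfolding derived_def commutators_def[symmetric] by (auto intro: generate.incl)
  then have "list_prod cs \<in> derived G (carrier G)" if "set cs \<subseteq> commutators" for cs
    using that by (induction cs) auto
  then show "(\<Union>n. commutator_products n) \<subseteq> derived G (carrier G)"
    unfolding commutator_products_def by blast
qed

lemma cl_eq_Least:
  "cl G g = (LEAST n. \<exists>cs. length cs = n \<and> set cs \<subseteq> commutators \<and> list_prod cs = g)"
  unfolding cl_def commutators_def ..

lemma cl_le:
  assumes "x \<in> commutator_products n"
  shows "cl G x \<le> n"
proof -
  obtain cs where cs: "x = list_prod cs" "length cs \<le> n" "set cs \<subseteq> commutators"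
    using assms by (rule commutator_productsE)
  then have "cl G x \<le> length cs"
    unfolding cl_eq_Least by (intro Least_le exI[of _ cs]) simp
  then show ?thesis using cs by simp
qed

lemma commutator_products_cl:
  assumes "x \<in> derived G (carrier G)"
  shows "x \<in> commutator_products (cl G x)"
proof -
  let ?P = "\<lambda>n. \<exists>cs. length cs = n \<and> set cs \<subseteq> commutators \<and> list_prod cs = x"
  obtain n where "x \<in> commutator_products n"
    using assms unfolding derived_eq_commutator_products by blast
  then obtain cs where "x = list_prod cs" "set cs \<subseteq> commutators"
    by (rule commutator_productsE)
  then have "?P (length cs)" by blast
  then have "?P (cl G x)"
    unfolding cl_eq_Least by (rule LeastI)
  then obtain ds where "length ds = cl G x" "set ds \<subseteq> commutators" "list_prod ds = x"
    by blast
  then show ?thesis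
    using commutator_productsI[of ds "cl G x"] by simp
qed

lemma cl_mult_le:
  assumes "x \<in> derived G (carrier G)" and "y \<in> derived G (carrier G)"
  shows "cl G (x \<otimes> y) \<le> cl G x + cl G y"
  using assms by (intro cl_le commutator_products_mult commutator_products_cl)

end

section \<open>Stable commutator length\<close>

lemma subadditive_multiple_le:
  fixes a :: "nat \<Rightarrow> real"
  assumes "\<And>m n. a (m + n) \<le> a m + a n" and "a 0 = 0"
  shows "a (q * m) \<le> real q * a m"
proof (induction q)
  case (Suc q)
  have "a (Suc q * m) \<le> a m + a (q * m)" using assms(1)[of m "q * m"] by simp
  also have "\<dots> \<le> a m + real q * a m" using Suc by simp
  finally show ?case by (simp add: algebra_simps)
qed (use assms in simp)

text \<open>
  Division with remainder by an \<open>m\<close> for which \<open>a m / m\<close> is almost the infimum shows that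
  \<open>a n / n\<close> is almost the infimum for all large \<open>n\<close>.
\<close>

lemma fekete:
  fixes a :: "nat \<Rightarrow> real"
  assumes subadd: "\<And>m n. a (m + n) \<le> a m + a n" and nonneg: "\<And>n. 0 \<le> a n" and zero: "a 0 = 0"
  shows "convergent (\<lambda>n. a n / real n)"
proof -
  define L where "L = (INF n\<in>{1..}. a n / real n)"
  have bdd: "bdd_below ((\<lambda>n. a n / real n) ` {1..})"
    by (intro bdd_belowI[of _ 0]) (auto simp: nonneg)
  have lower: "L \<le> a n / real n" if "n \<ge> 1" for n
    unfolding L_def using bdd that by (intro cINF_lower) auto
  have "(\<lambda>n. a n / real n) \<longlonglongrightarrow> L"
  proof (rule LIMSEQ_I)
    fix e :: real assume "e > 0"
    obtain m where m: "m \<ge> 1" "a m / real m < L + e / 2"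
      using cINF_less_iff[OF _ bdd, of "L + e / 2"] \<open>e > 0\<close> unfolding L_def by auto
    \<comment> \<open>A bound for the contribution of the remainder.\<close>
  define C where "C = (\<Sum>r<m. a r)"
    have C: "a r \<le> C" if "r < m" for r
      unfolding C_def using that nonneg by (intro member_le_sum) auto
    obtain N0 :: nat where N0: "2 * C / e < real N0"
      using reals_Archimedean2 by blast
    define N where "N = Suc N0"
    have N: "real N > 2 * C / e" "N \<ge> 1"
      using N0 unfolding N_def by auto
    have "norm (a n / real n - L) < e" if "n \<ge> N" for n
    proof -
      have n: "n \<ge> 1" using that N by simp
      have "a n \<le> a (n div m * m) + a (n mod m)"
        using subadd[of "n div m * m" "n mod m"] by simp
      also have "\<dots> \<le> real (n div m) * a m + C"
        using subadditive_multiple_le[of a, OF subadd zero, of "n div m" m] C[of "n mod m"] m by simp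
      also have "real (n div m) * a m \<le> real n * (a m / real m)"
      proof -
        have "real (n div m * m) \<le> real n"
          using div_mult_mod_eq[of n m] by linarith
        then have "real (n div m) \<le> real n / real m"
          using m(1) by (simp add: field_simps)
        then have "real (n div m) * a m \<le> real n / real m * a m"
          by (intro mult_right_mono nonneg)
        then show ?thesis by simp
      qed
      finally have "a n / real n \<le> a m / real m + C / real n"
        using n by (simp add: field_simps)
      also have "C / real n < e / 2"
      proof -
        have "2 * C / e < real n" using N that by linarith
        then have "2 * C < real n * e" using \<open>e > 0\<close> by (simp add: pos_divide_less_eq)
        then show ?thesis using n by (simp add: field_simps)
      qed
      finally show ?thesis using m(2) lower[OF n] by simp
    qed
    then show "\<exists>no. \<forall>n\<ge>no. norm (a n / real n - L) < e" by blast
  qed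
  then show ?thesis by (auto simp: convergent_def)
qed

context group
begin

lemma derived_pow:
  assumes "g \<in> derived G (carrier G)"
  shows "g [^] (n::nat) \<in> derived G (carrier G)"
proof -
  interpret D: subgroup "derived G (carrier G)" G
    by (simp add: derived_is_subgroup)
  show ?thesis using assms by (induction n) auto
qed

lemma scl_limit:
  assumes "g \<in> derived G (carrier G)"
  shows "(\<lambda>n. real (cl G (g [^] n)) / real n) \<longlonglongrightarrow> scl G g"
proof -
  have g: "g \<in> carrier G"
    using assms derived_in_carrier by blast
  have "convergent (\<lambda>n. real (cl G (g [^] n)) / real n)"
  proof (rule fekete)
    show "real (cl G (g [^] (m + n))) \<le> real (cl G (g [^] m)) + real (cl G (g [^] n))"
      for m n :: nat
      using cl_mult_le[OF derived_pow derived_pow, OF assms assms, of m n] g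
      by (simp add: nat_pow_mult)
    show "real (cl G (g [^] (0::nat))) = 0"
      using cl_le[OF one_commutator_products, of 0] by simp
  qed simp
  then show ?thesis
    unfolding scl_def by (simp add: convergent_LIMSEQ_iff)
qed

text \<open>
  The bound is used for the powers \<open>h\<^sup>n\<close>: the sequence \<open>cl (h\<^sup>n\<^sup>k) / (n k)\<close> computes the stable
  commutator length of \<open>h\<close> in the subgroup as well, and \<open>C / (n k)\<close> tends to 0.
\<close>

lemma scl_bound:
  fixes k A C :: nat
  assumes H: "subgroup H G" and k: "k \<ge> 1"
    and bound: "\<And>h. h \<in> derived G H \<Longrightarrow> cl (G\<lparr>carrier := H\<rparr>) (h [^] k) \<le> A * cl G h + C"
    and h: "h \<in> derived G H"
  shows "scl (G\<lparr>carrier := H\<rparr>) h \<le> real A / real k * scl G h"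
proof -
  interpret K: group "G\<lparr>carrier := H\<rparr>"
    by (rule subgroup.subgroup_is_group[OF H group_axioms])
  have hK: "h \<in> derived (G\<lparr>carrier := H\<rparr>) (carrier (G\<lparr>carrier := H\<rparr>))"
    using h derived_consistent[OF subset_refl H] by simp
  have hG: "h \<in> derived G (carrier G)"
    using h mono_derived[OF subgroup.subset[OF H]] by blast
  then have hc: "h \<in> carrier G" using derived_in_carrier by blast
  have pow: "h [^] n \<in> derived G H" for n :: nat
    using K.derived_pow[OF hK, of n] derived_consistent[OF subset_refl H]
    by (simp add: nat_pow_consistent[symmetric])
  have "strict_mono (\<lambda>n. n * k)" using k by (auto simp: strict_mono_def)
  from LIMSEQ_subseq_LIMSEQ[OF K.scl_limit[OF hK] this]
  have left: "(\<lambda>n. real (cl (G\<lparr>carrier := H\<rparr>) (h [^] (n * k))) / real (n * k)) \<longlonglongrightarrow> scl (G\<lparr>carrier := H\<rparr>) h"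
    by (simp add: comp_def nat_pow_consistent[symmetric])
  have "(\<lambda>n. real A / real k * (real (cl G (h [^] n)) / real n) + real C / real k * (1 / real n))
      \<longlonglongrightarrow> real A / real k * scl G h + real C / real k * 0"
    by (intro tendsto_intros scl_limit hG lim_1_over_n)
  then have right: "(\<lambda>n. real A / real k * (real (cl G (h [^] n)) / real n) + real C / real k * (1 / real n))
      \<longlonglongrightarrow> real A / real k * scl G h" by simp
  show ?thesis
  proof (rule LIMSEQ_le[OF left right], intro exI[of _ 1] allI impI)
    fix n :: nat assume n: "n \<ge> 1"
    have "cl (G\<lparr>carrier := H\<rparr>) (h [^] (n * k)) \<le> A * cl G (h [^] n) + C"
      using bound[OF pow, of n] hc by (simp add: nat_pow_pow)
    then have "real (cl (G\<lparr>carrier := H\<rparr>) (h [^] (n * k))) \<le> real (A * cl G (h [^] n) + C)"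
      by (simp only: of_nat_le_iff)
    then have "real (cl (G\<lparr>carrier := H\<rparr>) (h [^] (n * k))) / real (n * k)
        \<le> real (A * cl G (h [^] n) + C) / real (n * k)"
      by (rule divide_right_mono) simp
    also have "\<dots> = real A / real k * (real (cl G (h [^] n)) / real n) + real C / real k * (1 / real n)"
      using n k by (simp add: field_simps)
    finally show "real (cl (G\<lparr>carrier := H\<rparr>) (h [^] (n * k))) / real (n * k)
        \<le> real A / real k * (real (cl G (h [^] n)) / real n) + real C / real k * (1 / real n)" .
  qed
qed

end

section \<open>Signed words and their contents\<close>

text \<open>
  Chains are written as functions with pointwise ring operations, so that \<open>of_nat k * c\<close> is the
  \<open>k\<close>-fold multiple of the chain \<open>c\<close>; all chains that occur are finite sums of such basis elements.
\<close>

definition single :: "'a \<Rightarrow> 'a \<Rightarrow> int" where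
  "single x = (\<lambda>y. of_bool (y = x))"

context group
begin

text \<open>
  The letter \<open>(x, True)\<close> stands for \<open>x\<close> and \<open>(x, False)\<close> for its formal inverse.  Values are taken
  in the group and contents in the free abelian group on it, where the formal inverse of \<open>x\<close>
  differs from the letter for the element \<open>inv x\<close>.
\<close>

definition word_value :: "('a \<times> bool) list \<Rightarrow> 'a" where
  "word_value w = list_prod (map (\<lambda>(x, e). if e then x else inv x) w)"

definition content :: "('a \<times> bool) list \<Rightarrow> 'a \<Rightarrow> int" where
  "content w = (\<Sum>(x, e)\<leftarrow>w. if e then single x else - single x)"

abbreviation letters :: "('a \<times> bool) set" where
  "letters \<equiv> carrier G \<times> UNIV"

lemma word_value_simps [simp]:
  "word_value [] = \<one>"
  "word_value ((x, e) # w) = (if e then x else inv x) \<otimes> word_value w"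
  by (auto simp: word_value_def)

lemma content_simps [simp]:
  "content [] = 0"
  "content ((x, e) # w) = (if e then single x else - single x) + content w"
  "content (v @ w) = content v + content w"
  by (auto simp: content_def)

lemma word_value_closed: "set w \<subseteq> letters \<Longrightarrow> word_value w \<in> carrier G"
  by (induction w) (auto split: if_splits)

lemma word_value_append:
  "set v \<subseteq> letters \<Longrightarrow> set w \<subseteq> letters \<Longrightarrow> word_value (v @ w) = word_value v \<otimes> word_value w"
  by (induction v) (auto simp: m_assoc word_value_closed)

lemma opposite_letter_in_balanced_word:
  assumes "content ((x, e) # w) = 0"
  shows "(x, \<not> e) \<in> set w"
proof (rule ccontr)
  assume "(x, \<not> e) \<notin> set w"
  then have "(if e then 1 else - 1) * content w x \<ge> 0"
  proof (induction w)
    case (Cons a w)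
    obtain y f where a: "a = (y, f)" by (cases a)
    show ?case
      using Cons by (cases e) (auto simp: a single_def split: if_splits)
  qed simp
  moreover have "content ((x, e) # w) x = 0"
    using assms by simp
  ultimately show False
    by (cases e) (simp_all add: single_def)
qed

text \<open>
  The first letter \<open>x\<close> of a balanced word \<open>x u x\<inverse> v\<close> can be cancelled against an opposite letter at
  the price of one commutator, because \<open>x u x\<inverse> v = [x, u] u v\<close>.
\<close>

lemma balanced_word_value:
  assumes "set w \<subseteq> letters" and "content w = 0"
  shows "word_value w \<in> commutator_products (length w)"
  using assms
proof (induction w rule: length_induct)
  case (1 w)
  show ?case
  proof (cases w)
    case Nil
    then show ?thesis by (simp add: one_commutator_products)
  next
    case (Cons a w')
    obtain x e where a: "a = (x, e)" by (cases a)
    obtain u v where uv: "w' = u @ (x, \<not> e) # v"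
      using opposite_letter_in_balanced_word[of x e w'] 1(3) split_list[of "(x, \<not> e)" w']
      unfolding Cons a by blast
    have closed: "x \<in> carrier G" "set u \<subseteq> letters" "set v \<subseteq> letters"
      using 1(2) unfolding Cons a uv by auto
    define y where "y = (if e then x else inv x)"
    have y: "y \<in> carrier G" "inv y = (if \<not> e then x else inv x)"
      using closed(1) unfolding y_def by auto
    have u: "word_value u \<in> carrier G" and v: "word_value v \<in> carrier G"
      using closed by (auto intro: word_value_closed)
    have "word_value w = y \<otimes> (word_value u \<otimes> (inv y \<otimes> word_value v))"
      unfolding Cons a uv using closed y
      by (subst word_value_simps(2), subst word_value_append) (auto simp: y_def)
    also have "\<dots> = (y \<otimes> word_value u \<otimes> inv y \<otimes> inv (word_value u)) \<otimes> word_value (u @ v)"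
      unfolding word_value_append[OF closed(2,3)] using y(1) u v
      by (simp add: m_assoc) (simp add: m_assoc[symmetric])
    also have "\<dots> \<in> commutator_products (1 + length (u @ v))"
    proof (rule commutator_products_mult)
      show "y \<otimes> word_value u \<otimes> inv y \<otimes> inv (word_value u) \<in> commutator_products 1"
        using commutatorI[OF y(1) u] commutators_subset_products by blast
      have "content (u @ v) = content w"
        unfolding Cons a uv by (cases e) (simp_all add: zero_fun_def)
      then have "content (u @ v) = 0"
        using 1(3) by (simp only:)
      then show "word_value (u @ v) \<in> commutator_products (length (u @ v))"
        using closed unfolding Cons uv by (intro 1(1)[rule_format]) (simp_all add: Cons uv del: content_simps)
    qed
    also have "\<dots> \<subseteq> commutator_products (length w)"
      by (rule commutator_products_mono) (simp add: Cons uv)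
    finally show ?thesis .
  qed
qed

lemma word_value_map_True:
  "word_value (map (\<lambda>x. (x, True)) xs) = list_prod xs"
  by (induction xs) auto

lemma word_value_map_False:
  "set xs \<subseteq> carrier G \<Longrightarrow> word_value (map (\<lambda>x. (x, False)) (rev xs)) = inv (list_prod xs)"
proof (induction xs)
  case (Cons x xs)
  have *: "set (map (\<lambda>x. (x, False)) (rev xs)) \<subseteq> letters" "set [(x, False)] \<subseteq> letters"
    using Cons.prems by auto
  have "word_value (map (\<lambda>x. (x, False)) (rev (x # xs)))
      = word_value (map (\<lambda>x. (x, False)) (rev xs) @ [(x, False)])" by simp
  also have "\<dots> = inv (list_prod xs) \<otimes> inv x"
    unfolding word_value_append[OF *] using Cons by simp
  also have "\<dots> = inv (list_prod (x # xs))"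
    using Cons.prems list_prod_closed[of xs] by (simp add: inv_mult_group)
  finally show ?case .
qed simp

lemma content_map_True: "content (map (\<lambda>x. (x, True)) xs) = (\<Sum>x\<in>#mset xs. single x)"
  by (induction xs) auto

lemma content_map_False: "content (map (\<lambda>x. (x, False)) xs) = - (\<Sum>x\<in>#mset xs. single x)"
  by (induction xs) auto

lemma list_prod_permute:
  assumes "mset xs = mset ys" and "set xs \<subseteq> carrier G"
  shows "list_prod xs \<otimes> inv (list_prod ys) \<in> commutator_products (2 * length xs)"
proof -
  have ys: "set ys \<subseteq> carrier G" "length ys = length xs"
    using assms mset_eq_setD mset_eq_length by metis+
  let ?w = "map (\<lambda>x. (x, True)) xs @ map (\<lambda>x. (x, False)) (rev ys)"
  have "word_value ?w \<in> commutator_products (length ?w)"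
    using assms ys by (intro balanced_word_value) (auto simp: content_map_True content_map_False)
  moreover have "word_value ?w = list_prod xs \<otimes> inv (list_prod ys)"
    using assms ys
    by (subst word_value_append) (auto simp: word_value_map_True word_value_map_False)
  ultimately show ?thesis using ys by (simp add: mult_2)
qed

end

section \<open>Words over a finite set with product in the commutator subgroup\<close>

text \<open>
  From each position the subsequence moves on to a place where the minimum of the remaining
  values is attained.
\<close>

lemma nondecreasing_subsequence:
  fixes a :: "nat \<Rightarrow> nat"
  shows "\<exists>r :: nat \<Rightarrow> nat. strict_mono r \<and> (\<forall>i j. i \<le> j \<longrightarrow> a (r i) \<le> a (r j))"
proof -
  define next_min where "next_min n = (ARG_MIN a m. m \<ge> n)" for n
  have ge: "next_min n \<ge> n" and least: "m \<ge> n \<Longrightarrow> a (next_min n) \<le> a m" for m n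
    unfolding next_min_def
    using arg_min_natI[of "\<lambda>m. m \<ge> n" n a] arg_min_nat_le[of "\<lambda>m. m \<ge> n" m a] by auto
  define r where "r = rec_nat (next_min 0) (\<lambda>_ m. next_min (Suc m))"
  have r: "r 0 = next_min 0" "r (Suc i) = next_min (Suc (r i))" for i
    by (simp_all add: r_def)
  have "strict_mono r"
    unfolding strict_mono_Suc_iff using ge r(2) Suc_le_lessD by metis
  moreover have "a (r i) \<le> a (r (Suc i))" for i
  proof (cases i)
    case 0
    then show ?thesis by (simp add: r least)
  next
    case (Suc k)
    have "Suc (r k) \<le> r (Suc i)"
      using \<open>strict_mono r\<close> Suc by (metis Suc_le_eq less_SucI lessI strict_mono_less)
    then show ?thesis
      using least[of "Suc (r k)"] r(2)[of k] Suc by simp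
  qed
  then have "a (r i) \<le> a (r j)" if "i \<le> j" for i j
    using that lift_Suc_mono_le[of "\<lambda>i. a (r i)"] by blast
  ultimately show ?thesis by (intro exI[of _ r]) simp
qed

lemma simultaneous_nondecreasing_subsequence:
  fixes a :: "nat \<Rightarrow> 's \<Rightarrow> nat"
  assumes "finite S"
  shows "\<exists>r :: nat \<Rightarrow> nat. strict_mono r \<and> (\<forall>s\<in>S. \<forall>i j. i \<le> j \<longrightarrow> a (r i) s \<le> a (r j) s)"
  using assms
proof (induction S)
  case empty
  show ?case by (rule exI[of _ id]) (auto simp: strict_mono_def)
next
  case (insert s S)
  obtain r :: "nat \<Rightarrow> nat" where r': "strict_mono r \<and> (\<forall>s\<in>S. \<forall>i j. i \<le> j \<longrightarrow> a (r i) s \<le> a (r j) s)"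
    using insert.IH ..
  note r = conjunct1[OF r'] conjunct2[OF r']
  obtain q :: "nat \<Rightarrow> nat" where q': "strict_mono q \<and> (\<forall>i j. i \<le> j \<longrightarrow> a (r (q i)) s \<le> a (r (q j)) s)"
    using nondecreasing_subsequence[of "\<lambda>i. a (r i) s"] ..
  note q = conjunct1[OF q'] conjunct2[OF q']
  have "strict_mono (r \<circ> q)"
    using r(1) q(1) by (simp add: strict_mono_o)
  moreover have "q i \<le> q j" if "i \<le> j" for i j
    using q(1) that by (simp add: strict_mono_less_eq)
  ultimately show ?case
    using r(2) q(2) by (intro exI[of _ "r \<circ> q"]) (simp add: comp_def)
qed

text \<open>
  The minimal elements of \<open>\<M>\<close> form an antichain, while an infinite family of multisets over a
  finite set has a subsequence along which all multiplicities are nondecreasing.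
\<close>

lemma dickson:
  fixes \<M> :: "'s multiset set"
  assumes "finite S" and "\<And>A. A \<in> \<M> \<Longrightarrow> set_mset A \<subseteq> S"
  shows "\<exists>F \<subseteq> \<M>. finite F \<and> (\<forall>A\<in>\<M>. \<exists>B\<in>F. B \<subseteq># A)"
proof -
  define F where "F = {B \<in> \<M>. \<forall>A\<in>\<M>. A \<subseteq># B \<longrightarrow> A = B}"
  have "\<exists>B\<in>F. B \<subseteq># A" if "A \<in> \<M>" for A
    using that
  proof (induction "size A" arbitrary: A rule: less_induct)
    case less
    show ?case
    proof (cases "A \<in> F")
      case False
      then obtain C where "C \<in> \<M>" "C \<subset># A"
        using less.prems unfolding F_def by (auto simp: subset_mset.less_le)
      then show ?thesis
        using less.hyps[of C] mset_subset_size[of C A] subset_mset.trans[of _ C A]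
        by (meson subset_mset.less_imp_le)
    qed auto
  qed
  moreover have "finite F"
  proof (rule ccontr)
    assume "infinite F"
    then obtain f :: "nat \<Rightarrow> 's multiset" where f: "inj f" "range f \<subseteq> F"
      using infinite_countable_subset by blast
    obtain r :: "nat \<Rightarrow> nat" where r': "strict_mono r \<and>
        (\<forall>s\<in>S. \<forall>i j. i \<le> j \<longrightarrow> count (f (r i)) s \<le> count (f (r j)) s)"
      using simultaneous_nondecreasing_subsequence[OF assms(1), of "\<lambda>i. count (f i)"] ..
    note r = conjunct1[OF r'] conjunct2[OF r']
    have F: "f (r i) \<in> F" "f (r i) \<in> \<M>" for i
      using f(2) unfolding F_def by auto
    have "count (f (r 0)) s \<le> count (f (r 1)) s" for s
    proof (cases "s \<in> S")
      case False
      then have "s \<notin># f (r 0)" using assms(2)[OF F(2)] by blast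
      then show ?thesis by (simp add: not_in_iff)
    qed (use r(2) in simp)
    then have "f (r 0) = f (r 1)"
      using F unfolding F_def by (auto simp: subseteq_mset_def)
    then have "r 0 = r 1" using f(1) by (simp add: inj_eq)
    then show False using r(1) by (simp add: strict_mono_eq)
  qed
  ultimately show ?thesis
    unfolding F_def by (intro exI[of _ F]) (auto simp: F_def)
qed

context group
begin

lemma derived_list_prod_permute:
  assumes "mset xs = mset ys" and "set xs \<subseteq> carrier G" and "list_prod xs \<in> derived G (carrier G)"
  shows "list_prod ys \<in> derived G (carrier G)"
proof -
  interpret D: subgroup "derived G (carrier G)" G
    by (simp add: derived_is_subgroup)
  have ys: "set ys \<subseteq> carrier G"
    using assms(1,2) mset_eq_setD by metis
  have "list_prod ys \<otimes> inv (list_prod xs) \<in> derived G (carrier G)"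
    using list_prod_permute[of ys xs] assms ys unfolding derived_eq_commutator_products by auto
  then have "list_prod ys \<otimes> inv (list_prod xs) \<otimes> list_prod xs \<in> derived G (carrier G)"
    using assms(3) by blast
  then show ?thesis
    using assms(2) ys by (simp add: m_assoc list_prod_closed)
qed

text \<open>
  Whether the product of a word lies in the commutator subgroup depends only on the multiset of
  its letters.  If two such multisets are nested, then their difference is another one; so by
  Dickson's lemma all of them are sums of finitely many of them.  A word of length \<open>m\<close> needs at
  most \<open>m\<close> summands, each of bounded commutator length, and sorting its letters accordingly costs
  at most \<open>2 m\<close> commutators.
\<close>

lemma commutator_length_of_words:
  assumes "finite S" and "S \<subseteq> carrier G"
  shows "\<exists>C. \<forall>ss. set ss \<subseteq> S \<and> list_prod ss \<in> derived G (carrier G) \<longrightarrow>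
                   list_prod ss \<in> commutator_products (C * length ss)"
proof -
  let ?D = "derived G (carrier G)"
  interpret D: subgroup ?D G
    by (simp add: derived_is_subgroup)
  define trivial where "trivial A \<longleftrightarrow> set_mset A \<subseteq> S \<and> (\<forall>ss. mset ss = A \<longrightarrow> list_prod ss \<in> ?D)" for A
  \<comment> \<open>The product of a word over such a multiset is in the commutator subgroup for any order of the letters.\<close>
  have trivialI: "trivial (mset ss)" if "set ss \<subseteq> S" "list_prod ss \<in> ?D" for ss
    using that assms(2) derived_list_prod_permute[of ss] unfolding trivial_def by auto
  define \<M> where "\<M> = {A. A \<noteq> {#} \<and> trivial A}"
  have "\<exists>F \<subseteq> \<M>. finite F \<and> (\<forall>A\<in>\<M>. \<exists>B\<in>F. B \<subseteq># A)"
    using assms(1) by (rule dickson) (simp add: \<M>_def trivial_def)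
  then obtain F where "F \<subseteq> \<M>" "finite F" "\<forall>A\<in>\<M>. \<exists>B\<in>F. B \<subseteq># A"
    by blast
  then have F: "F \<subseteq> {A. A \<noteq> {#} \<and> trivial A}" "finite F"
      "\<And>A. A \<noteq> {#} \<Longrightarrow> trivial A \<Longrightarrow> \<exists>B\<in>F. B \<subseteq># A"
    unfolding \<M>_def by simp_all
  define pick where "pick A = (SOME ss :: 'a list. mset ss = A)" for A
  have pick: "mset (pick A) = A" for A
    unfolding pick_def by (rule someI_ex) (rule ex_mset)
  define C where "C = Max (insert 0 ((\<lambda>A. cl G (list_prod (pick A))) ` F))"
  have C: "list_prod (pick A) \<in> commutator_products C" if "A \<in> F" for A
  proof -
    have "list_prod (pick A) \<in> ?D"
      using that F(1) pick unfolding trivial_def by blast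
    moreover have "cl G (list_prod (pick A)) \<le> C"
      unfolding C_def using that F(2) by (intro Max_ge) auto
    ultimately show ?thesis
      using commutator_products_cl commutator_products_mono by blast
  qed
  have decompose: "\<exists>As. set As \<subseteq> F \<and> length As \<le> size A \<and> A = sum_list As" if "trivial A" for A
    using that
  proof (induction "size A" arbitrary: A rule: less_induct)
    case less
    show ?case
    proof (cases "A = {#}")
      case True
      then show ?thesis by (intro exI[of _ "[]"]) auto
    next
      case False
      then obtain B where B: "B \<in> F" "B \<subseteq># A"
        using F(3) less.prems by blast
      have B': "B \<noteq> {#}" "trivial B" using B F(1) by auto
      then have size: "size (A - B) < size A" "size A = size (A - B) + size B"
        using B(2) size_mset_mono[OF B(2)] by (auto simp: size_Diff_submset nonempty_has_size)
      have "list_prod ss \<in> ?D" if ss: "mset ss = A - B" for ss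
      proof -
        have "mset (pick B @ ss) = A"
          using B(2) by (simp add: pick ss)
        then have "list_prod (pick B @ ss) \<in> ?D"
          using less.prems unfolding trivial_def by blast
        moreover have closed: "set (pick B) \<subseteq> carrier G" "set ss \<subseteq> carrier G"
          using B'(2) less.prems pick[of B] ss assms(2) unfolding trivial_def
          by (metis set_mset_mset subset_trans) (metis in_diffD less.prems set_mset_mset ss subset_iff trivial_def assms(2))
        ultimately have "list_prod (pick B) \<otimes> list_prod ss \<in> ?D"
          by (simp only: list_prod_append)
        moreover have "inv (list_prod (pick B)) \<in> ?D"
          using B'(2) pick[of B] unfolding trivial_def by blast
        ultimately have "inv (list_prod (pick B)) \<otimes> (list_prod (pick B) \<otimes> list_prod ss) \<in> ?D"
          by blast
        then show ?thesis
          using closed by (simp add: m_assoc[symmetric] list_prod_closed)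
      qed
      then have "trivial (A - B)"
        using less.prems unfolding trivial_def by (auto dest: in_diffD)
      then obtain As where As: "set As \<subseteq> F" "length As \<le> size (A - B)" "A - B = sum_list As"
        using less.hyps size(1) by blast
      have "A = B + (A - B)" using B(2) by simp
      then have "A = sum_list (B # As)" by (simp add: As(3))
      moreover have "length (B # As) \<le> size A"
        using As(2) size(2) B'(1) nonempty_has_size[of B] by simp
      ultimately show ?thesis
        using B(1) As(1) by (intro exI[of _ "B # As"]) simp
    qed
  qed
  show ?thesis
  proof (intro exI[of _ "C + 2"] allI impI)
    fix ss assume ss: "set ss \<subseteq> S \<and> list_prod ss \<in> ?D"
    obtain As where As: "set As \<subseteq> F" "length As \<le> length ss" "mset ss = sum_list As"
      using decompose[of "mset ss"] trivialI ss by auto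
    have bound: "set (concat (map pick As)) \<subseteq> carrier G \<and>
        list_prod (concat (map pick As)) \<in> commutator_products (C * length As)"
      using As(1)
    proof (induction As)
      case Nil
      then show ?case by (simp add: one_commutator_products)
    next
      case (Cons A As)
      have "set (pick A) \<subseteq> carrier G"
        using Cons.prems F(1) pick[of A] assms(2) unfolding trivial_def
        by (metis (mono_tags, lifting) list.set_intros(1) mem_Collect_eq set_mset_mset subset_iff)
      moreover have IH: "set (concat (map pick As)) \<subseteq> carrier G"
          "list_prod (concat (map pick As)) \<in> commutator_products (C * length As)"
        using Cons by auto
      ultimately have "list_prod (concat (map pick (A # As))) =
          list_prod (pick A) \<otimes> list_prod (concat (map pick As))"
        by (simp only: list.map concat.simps list_prod_append)
      also have "\<dots> \<in> commutator_products (C + C * length As)"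
        using commutator_products_mult[OF C IH(2)] Cons.prems by simp
      finally show ?case
        using \<open>set (pick A) \<subseteq> carrier G\<close> IH(1) by simp
    qed
    have mset: "mset (concat (map pick As)) = sum_list As"
      by (induction As) (auto simp: pick)
    have closed: "set ss \<subseteq> carrier G" using ss assms(2) by blast
    have "list_prod ss = list_prod ss \<otimes> inv (list_prod (concat (map pick As))) \<otimes> list_prod (concat (map pick As))"
      using bound closed by (simp add: m_assoc list_prod_closed)
    also have "\<dots> \<in> commutator_products (2 * length ss + C * length As)"
      using bound list_prod_permute[of ss "concat (map pick As)"] As(3) mset closed
      by (intro commutator_products_mult) auto
    also have "\<dots> \<subseteq> commutator_products ((C + 2) * length ss)"
      using As(2) by (intro commutator_products_mono) (simp add: algebra_simps)
    finally show "list_prod ss \<in> commutator_products ((C + 2) * length ss)" .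
  qed
qed

end

section \<open>Filling chains by triangles\<close>

context group
begin

definition triangle :: "'a \<Rightarrow> 'a \<Rightarrow> 'a \<Rightarrow> int" where
  "triangle x y = single x + single y - single (x \<otimes> y)"

definition relators :: "'a set \<Rightarrow> ('a \<Rightarrow> int) set" where
  "relators S = (\<lambda>(x, y). triangle x y) ` (carrier G \<times> carrier G) \<union> (\<lambda>s. single s) ` S"

text \<open>
  Triangles and elements of \<open>S\<close> count alike for the filling length of a chain.  The length may be
  infinite, so it is replaced by the sets of chains that it bounds.
\<close>

definition filled :: "'a set \<Rightarrow> nat \<Rightarrow> ('a \<Rightarrow> int) set" where
  "filled S n = {sum_list rs | rs. length rs \<le> n \<and> set rs \<subseteq> relators S \<union> uminus ` relators S}"

lemma filledI:
  "length rs \<le> n \<Longrightarrow> set rs \<subseteq> relators S \<union> uminus ` relators S \<Longrightarrow> sum_list rs \<in> filled S n"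
  unfolding filled_def by blast

lemma filledE:
  assumes "c \<in> filled S n"
  obtains rs where "c = sum_list rs" "length rs \<le> n" "set rs \<subseteq> relators S \<union> uminus ` relators S"
  using assms unfolding filled_def by blast

lemma zero_filled: "0 \<in> filled S n"
  using filledI[of "[]" n S] by simp

lemma filled_mono: "m \<le> n \<Longrightarrow> c \<in> filled S m \<Longrightarrow> c \<in> filled S n"
  by (elim filledE) (auto intro: filledI)

lemma filled_add:
  assumes "c \<in> filled S m" and "d \<in> filled S n"
  shows "c + d \<in> filled S (m + n)"
proof -
  obtain rs where rs: "c = sum_list rs" "length rs \<le> m" "set rs \<subseteq> relators S \<union> uminus ` relators S"
    using assms(1) by (rule filledE)
  obtain qs where qs: "d = sum_list qs" "length qs \<le> n" "set qs \<subseteq> relators S \<union> uminus ` relators S"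
    using assms(2) by (rule filledE)
  show ?thesis
    using filledI[of "rs @ qs" "m + n" S] rs qs by simp
qed

lemma filled_uminus:
  assumes "c \<in> filled S n"
  shows "- c \<in> filled S n"
proof -
  obtain rs where rs: "c = sum_list rs" "length rs \<le> n" "set rs \<subseteq> relators S \<union> uminus ` relators S"
    using assms by (rule filledE)
  have "- sum_list rs = sum_list (map uminus rs)"
    using uminus_sum_list_map[of id rs] by (simp only: comp_id list.map_id)
  moreover have "set (map uminus rs) \<subseteq> relators S \<union> uminus ` relators S"
    using rs(3) by fastforce
  ultimately show ?thesis
    using filledI[of "map uminus rs" n S] rs by simp
qed

lemma filled_diff: "c \<in> filled S m \<Longrightarrow> d \<in> filled S n \<Longrightarrow> c - d \<in> filled S (m + n)"
  using filled_add[of c S m "- d" n] filled_uminus[of d S n] by simp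

lemma filled_sum:
  assumes "\<And>i. i \<in> I \<Longrightarrow> f i \<in> filled S (n i)"
  shows "sum f I \<in> filled S (sum n I)"
  using assms
  by (induction I rule: infinite_finite_induct) (auto simp: zero_filled intro!: filled_add)

lemma filled_of_nat_mult:
  assumes "c \<in> filled S n"
  shows "of_nat k * c \<in> filled S (k * n)"
proof (induction k)
  case (Suc k)
  then show ?case
    using filled_add[OF assms, of "of_nat k * c" "k * n"]
    by (simp only: of_nat_Suc distrib_right mult_1 mult_Suc)
qed (simp only: of_nat_0 mult_zero_left zero_filled)

lemma triangle_filled: "x \<in> carrier G \<Longrightarrow> y \<in> carrier G \<Longrightarrow> triangle x y \<in> filled S 1"
  using filledI[of "[triangle x y]" 1 S] unfolding relators_def by auto

lemma single_filled: "s \<in> S \<Longrightarrow> single s \<in> filled S 1"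
  using filledI[of "[single s]" 1 S] unfolding relators_def by auto

lemma relatorsE:
  assumes "r \<in> relators S"
  obtains x y where "x \<in> carrier G" "y \<in> carrier G" "r = triangle x y" | s where "s \<in> S" "r = single s"
  using assms unfolding relators_def by (elim UnE imageE) auto

text \<open>
  These words serve to cancel a filling letter by letter.  Triangles cost nothing in the group,
  because \<open>x y (x y)\<inverse>\<close> has the value 1.
\<close>

lemma relator_word:
  assumes S: "S \<subseteq> carrier G" and r: "r \<in> relators S \<union> uminus ` relators S"
  shows "\<exists>w ss. set w \<subseteq> letters \<and> length w \<le> 3 \<and> content w = - r \<and>
           set ss \<subseteq> S \<union> m_inv G ` S \<and> length ss \<le> 1 \<and> word_value w = list_prod ss"
proof -
  consider x y where "x \<in> carrier G" "y \<in> carrier G" "r = triangle x y"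
    | x y where "x \<in> carrier G" "y \<in> carrier G" "r = - triangle x y"
    | s where "s \<in> S" "r = single s" | s where "s \<in> S" "r = - single s"
    using r
  proof
    assume "r \<in> relators S"
    then show ?thesis by (rule relatorsE) (use that(1,3) in \<open>simp_all only:\<close>)
  next
    assume "r \<in> uminus ` relators S"
    then obtain q where "r = - q" "q \<in> relators S" by (rule imageE)
    from this(2) show ?thesis
      by (rule relatorsE) (use that(2,4) \<open>r = - q\<close> in \<open>simp_all only:\<close>)
  qed
  then show ?thesis
  proof cases
    case 1
    let ?w = "[(x \<otimes> y, True), (y, False), (x, False)]"
    have "word_value ?w = list_prod []"
      using 1 by (simp add: inv_mult_group[symmetric])
    moreover have "content ?w = - r"
      unfolding 1(3) by (simp add: triangle_def fun_eq_iff)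
    moreover have "set ?w \<subseteq> letters" using 1 by simp
    ultimately show ?thesis
      by (intro exI[of _ ?w] exI[of _ "[]"]) (simp del: content_simps word_value_simps)
  next
    case 2
    let ?w = "[(x, True), (y, True), (x \<otimes> y, False)]"
    have "word_value ?w = x \<otimes> (y \<otimes> inv (x \<otimes> y))"
      using 2 by simp
    also have "\<dots> = (x \<otimes> y) \<otimes> inv (x \<otimes> y)"
      using 2 by (intro m_assoc[symmetric]) auto
    finally have "word_value ?w = list_prod []"
      using 2 by simp
    moreover have "content ?w = - r"
      unfolding 2(3) by (simp add: triangle_def fun_eq_iff)
    moreover have "set ?w \<subseteq> letters" using 2 by simp
    ultimately show ?thesis
      by (intro exI[of _ ?w] exI[of _ "[]"]) (simp del: content_simps word_value_simps)
  next
    case 3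
    then show ?thesis
      using S by (intro exI[of _ "[(s, False)]"] exI[of _ "[inv s]"]) (auto simp: fun_eq_iff)
  next
    case 4
    then show ?thesis
      using S by (intro exI[of _ "[(s, True)]"] exI[of _ "[s]"]) (auto simp: fun_eq_iff)
  qed
qed

lemma relators_word:
  assumes S: "S \<subseteq> carrier G" and "set rs \<subseteq> relators S \<union> uminus ` relators S"
  shows "\<exists>w ss. set w \<subseteq> letters \<and> length w \<le> 3 * length rs \<and> content w = - sum_list rs \<and>
           set ss \<subseteq> S \<union> m_inv G ` S \<and> length ss \<le> length rs \<and> word_value w = list_prod ss"
  using assms(2)
proof (induction rs)
  case Nil
  then show ?case by (intro exI[of _ "[]"]) simp
next
  case (Cons r rs)
  obtain w ss where w: "set w \<subseteq> letters" "length w \<le> 3 * length rs" "content w = - sum_list rs"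
      "set ss \<subseteq> S \<union> m_inv G ` S" "length ss \<le> length rs" "word_value w = list_prod ss"
    using Cons.IH[OF order_trans[OF set_subset_Cons Cons.prems]] by blast
  obtain v ts where v: "set v \<subseteq> letters" "length v \<le> 3" "content v = - r"
      "set ts \<subseteq> S \<union> m_inv G ` S" "length ts \<le> 1" "word_value v = list_prod ts"
    using relator_word[OF S subsetD[OF Cons.prems list.set_intros(1)]] by blast
  have "set ss \<subseteq> carrier G" "set ts \<subseteq> carrier G"
    using w(4) v(4) S by auto
  then have "word_value (v @ w) = list_prod (ts @ ss)"
    by (simp only: word_value_append[OF v(1) w(1)] list_prod_append v(6) w(6))
  moreover have "content (v @ w) = - sum_list (r # rs)"
    by (simp only: content_simps v(3) w(3) sum_list.Cons minus_add_distrib)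
  ultimately show ?case
    using v w by (intro exI[of _ "v @ w"] exI[of _ "ts @ ss"]) simp
qed

lemma content_replicate: "content (replicate k (h, True)) = of_nat k * single h"
proof (induction k)
  case (Suc k)
  then show ?case
    by (simp only: of_nat_Suc distrib_right mult_1 replicate_Suc content_simps if_True)
qed (simp only: of_nat_0 mult_zero_left replicate_0 content_simps)

lemma word_value_replicate: "h \<in> carrier G \<Longrightarrow> word_value (replicate k (h, True)) = h [^] k"
  using word_value_map_True[of "replicate k h"] list_prod_replicate[of h k] by simp

text \<open>
  Appending the words of the relators in a filling of \<open>k [h]\<close> to the word \<open>h\<^sup>k\<close> makes it balanced,
  so that \<open>h\<^sup>k\<close> is a product of commutators up to a product of few elements of \<open>S\<close> and inverses.
\<close>

lemma filled_power:
  assumes "finite S" and S: "S \<subseteq> carrier G"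
  shows "\<exists>C. \<forall>h\<in>derived G (carrier G). \<forall>k m. of_nat k * single h \<in> filled S m \<longrightarrow>
                h [^] k \<in> commutator_products (k + C * m)"
proof -
  interpret D: subgroup "derived G (carrier G)" G
    by (simp add: derived_is_subgroup)
  have S': "S \<union> m_inv G ` S \<subseteq> carrier G" "finite (S \<union> m_inv G ` S)"
    using assms by auto
  obtain C where C: "\<And>ss. set ss \<subseteq> S \<union> m_inv G ` S \<Longrightarrow> list_prod ss \<in> derived G (carrier G) \<Longrightarrow>
      list_prod ss \<in> commutator_products (C * length ss)"
    using commutator_length_of_words[OF S'(2,1)] by auto
  show ?thesis
  proof (intro exI[of _ "C + 3"] ballI allI impI)
    fix h k m
    assume h: "h \<in> derived G (carrier G)" and fill: "of_nat k * single h \<in> filled S m"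
    have hc: "h \<in> carrier G" using h D.subset by blast
    obtain rs where rs: "of_nat k * single h = sum_list rs" "length rs \<le> m"
        "set rs \<subseteq> relators S \<union> uminus ` relators S"
      using fill by (rule filledE)
    obtain w ss where w: "set w \<subseteq> letters" "length w \<le> 3 * length rs" "content w = - sum_list rs"
      and ss: "set ss \<subseteq> S \<union> m_inv G ` S" "length ss \<le> length rs" "word_value w = list_prod ss"
      using relators_word[OF S rs(3)] by auto
    have ssc: "list_prod ss \<in> carrier G" using ss(1) S' by (intro list_prod_closed) blast
    let ?w = "replicate k (h, True) @ w"
    have "content ?w = 0"
      by (simp only: content_simps content_replicate w(3) rs(1) add.right_inverse)
    moreover have hw: "set (replicate k (h, True)) \<subseteq> letters" using hc by auto
    ultimately have "word_value ?w \<in> commutator_products (length ?w)"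
      using w(1) by (intro balanced_word_value) auto
    moreover have "word_value ?w = h [^] k \<otimes> list_prod ss"
      by (simp only: word_value_append[OF hw w(1)] word_value_replicate[OF hc] ss(3))
    ultimately have prod: "h [^] k \<otimes> list_prod ss \<in> commutator_products (k + 3 * m)"
      using commutator_products_mono[of "length ?w" "k + 3 * m"] w(2) rs(2) by auto
    have hk: "h [^] k \<in> derived G (carrier G)" using h by (rule derived_pow)
    have "inv (h [^] k) \<otimes> (h [^] k \<otimes> list_prod ss) \<in> derived G (carrier G)"
      using hk prod unfolding derived_eq_commutator_products[symmetric]
      by (metis D.m_closed D.m_inv_closed UN_I UNIV_I derived_eq_commutator_products)
    then have "list_prod ss \<in> derived G (carrier G)"
      using hc ssc by (simp add: m_assoc[symmetric])
    then have "inv (list_prod ss) \<in> commutator_products (C * length ss)"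
      using C ss(1) by (intro commutator_products_inv) blast
    then have "(h [^] k \<otimes> list_prod ss) \<otimes> inv (list_prod ss)
        \<in> commutator_products (k + 3 * m + C * length ss)"
      by (rule commutator_products_mult[OF prod])
    moreover have "(h [^] k \<otimes> list_prod ss) \<otimes> inv (list_prod ss) = h [^] k"
      using hc ssc by (simp add: m_assoc)
    moreover have "k + 3 * m + C * length ss \<le> k + (C + 3) * m"
      using ss(2) rs(2) by (simp add: algebra_simps)
    ultimately show "h [^] k \<in> commutator_products (k + (C + 3) * m)"
      using commutator_products_mono by (metis subsetD)
  qed
qed

end

section \<open>Walks in the relative Cayley graph\<close>

lemma relpow_subset:
  fixes R S :: "('a \<times> 'a) set"
  assumes "R \<subseteq> S"
  shows "R ^^ n \<subseteq> S ^^ n"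
  using assms by (induction n) (simp, simp only: relpow.simps, blast)

lemma relpow_sym: "sym R \<Longrightarrow> (x, y) \<in> R ^^ n \<Longrightarrow> (y, x) \<in> R ^^ n"
proof (induction n arbitrary: y)
  case (Suc n)
  then obtain z where "(x, z) \<in> R ^^ n" "(z, y) \<in> R" by auto
  then show ?case using Suc relpow_Suc_I2 by (metis symD)
qed auto

locale relative_cayley = group G for G (structure) +
  fixes H X :: "'a set"
  assumes subgroup_H: "subgroup H G"
    and X_closed: "X \<subseteq> carrier G"
    and generates: "generate G (X \<union> H) = carrier G"
begin

sublocale H: subgroup H G
  by (rule subgroup_H)

text \<open>
  The edges of the relative Cayley graph except those that are labelled by elements of \<open>H\<close> and
  have both ends in \<open>B\<close>.  Thus \<open>step {}\<close> is the adjacency relation of the whole graph, while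
  \<open>step H\<close> is the one that defines the relative metric on \<open>H\<close>.
\<close>

definition step :: "'a set \<Rightarrow> ('a \<times> 'a) set" where
  "step B = {(x, y). x \<in> carrier G \<and> y \<in> carrier G \<and>
     ((\<exists>a\<in>X. y = x \<otimes> a \<or> x = y \<otimes> a) \<or>
      (\<exists>a\<in>H - {\<one>}. y = x \<otimes> a \<or> x = y \<otimes> a) \<and> \<not> (x \<in> B \<and> y \<in> B))}"

lemma step_closed: "(x, y) \<in> step B \<Longrightarrow> x \<in> carrier G \<and> y \<in> carrier G"
  unfolding step_def by auto

lemma step_sym: "sym (step B)"
  unfolding step_def sym_def by blast

lemma step_avoiding: "(x, y) \<in> step {} \<Longrightarrow> \<not> (x \<in> B \<and> y \<in> B) \<Longrightarrow> (x, y) \<in> step B"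
  unfolding step_def by auto

lemma step_translate:
  assumes "(x, y) \<in> step B" and "g \<in> carrier G"
    and "\<And>z. z \<in> carrier G \<Longrightarrow> g \<otimes> z \<in> C \<Longrightarrow> z \<in> B"
  shows "(g \<otimes> x, g \<otimes> y) \<in> step C"
proof -
  have xy: "x \<in> carrier G" "y \<in> carrier G"
    using assms(1) by (auto dest: step_closed)
  have edge: "g \<otimes> y = g \<otimes> x \<otimes> a \<or> g \<otimes> x = g \<otimes> y \<otimes> a"
    if "y = x \<otimes> a \<or> x = y \<otimes> a" "a \<in> carrier G" for a
    using that xy assms(2) by (auto simp: m_assoc)
  have edges: "\<exists>a\<in>A. g \<otimes> y = g \<otimes> x \<otimes> a \<or> g \<otimes> x = g \<otimes> y \<otimes> a"
    if A: "\<exists>a\<in>A. y = x \<otimes> a \<or> x = y \<otimes> a" "A \<subseteq> carrier G" for A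
  proof -
    obtain a where "a \<in> A" "y = x \<otimes> a \<or> x = y \<otimes> a" using A(1) by blast
    then show ?thesis using edge[of a] A(2) by blast
  qed
  have "H - {\<one>} \<subseteq> carrier G" using H.subset by blast
  then show ?thesis
    using assms(1,2) xy edges[of X] edges[of "H - {\<one>}"] X_closed assms(3)[OF xy(1)] assms(3)[OF xy(2)]
    unfolding step_def mem_Collect_eq prod.case by (metis m_closed)
qed

definition reach :: "'a set \<Rightarrow> nat \<Rightarrow> ('a \<times> 'a) set" where
  "reach B n = {(x, y). \<exists>k\<le>n. (x, y) \<in> step B ^^ k}"

lemma reach_refl: "(x, x) \<in> reach B n"
  unfolding reach_def by (auto intro: exI[of _ 0])

lemma reach_step: "(x, y) \<in> step B \<Longrightarrow> (x, y) \<in> reach B 1"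
  unfolding reach_def by (auto intro: exI[of _ 1])

lemma reach_mono: "m \<le> n \<Longrightarrow> reach B m \<subseteq> reach B n"
  unfolding reach_def by (auto intro: order_trans)

lemma reach_sym: "(x, y) \<in> reach B n \<Longrightarrow> (y, x) \<in> reach B n"
  unfolding reach_def using relpow_sym[OF step_sym] by auto

lemma reach_trans:
  assumes "(x, y) \<in> reach B m" and "(y, z) \<in> reach B n"
  shows "(x, z) \<in> reach B (m + n)"
proof -
  obtain j k where "j \<le> m" "(x, y) \<in> step B ^^ j" "k \<le> n" "(y, z) \<in> step B ^^ k"
    using assms unfolding reach_def by auto
  then have "j + k \<le> m + n" "(x, z) \<in> step B ^^ (j + k)"
    by (auto simp: relpow_add)
  then show ?thesis unfolding reach_def by blast
qed

lemma reach_path: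
  assumes "m \<le> n" and "\<And>i. m \<le> i \<Longrightarrow> i < n \<Longrightarrow> (p i, p (Suc i)) \<in> step B"
  shows "(p m, p n) \<in> reach B (n - m)"
  using assms
proof (induction n rule: dec_induct)
  case base
  then show ?case by (simp add: reach_refl)
next
  case (step n)
  then show ?case
    using reach_trans[of "p m" "p n" B "n - m" "p (Suc n)" 1] reach_step[of "p n" "p (Suc n)" B]
    by (simp add: Suc_diff_le)
qed

lemma relpow_translate:
  assumes "(x, y) \<in> step B ^^ k" and "g \<in> carrier G"
    and "\<And>z. z \<in> carrier G \<Longrightarrow> g \<otimes> z \<in> C \<Longrightarrow> z \<in> B"
  shows "(g \<otimes> x, g \<otimes> y) \<in> step C ^^ k"
  using assms(1)
proof (induction k arbitrary: y)
  case (Suc k)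
  then show ?case using step_translate[OF _ assms(2,3)] by fastforce
qed auto

lemma reach_translate:
  assumes "(x, y) \<in> reach B k" and "g \<in> carrier G"
    and "\<And>z. z \<in> carrier G \<Longrightarrow> g \<otimes> z \<in> C \<Longrightarrow> z \<in> B"
  shows "(g \<otimes> x, g \<otimes> y) \<in> reach C k"
  using assms(1) relpow_translate[OF _ assms(2,3)] unfolding reach_def by auto

lemma connected_one: "g \<in> generate G (X \<union> H) \<Longrightarrow> \<exists>k. (\<one>, g) \<in> step {} ^^ k"
proof (induction rule: generate.induct)
  case one
  show ?case by (rule exI[of _ 0]) auto
next
  case (incl h)
  then have h: "h \<in> carrier G" using X_closed H.subset by auto
  show ?case
  proof (cases "h = \<one>")
    case False
    then have "(\<one>, h) \<in> step {}"
      using incl h unfolding step_def by (auto intro!: bexI[of _ h])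
    then show ?thesis by (intro exI[of _ 1]) auto
  qed (auto intro: exI[of _ 0])
next
  case (inv h)
  then have h: "h \<in> carrier G" using X_closed H.subset by auto
  show ?case
  proof (cases "h = \<one>")
    case False
    then have "(\<one>, inv h) \<in> step {}"
      using inv h unfolding step_def by (auto intro!: bexI[of _ h])
    then show ?thesis by (intro exI[of _ 1]) auto
  qed (auto intro: exI[of _ 0])
next
  case (eng g h)
  then obtain j k where jk: "(\<one>, g) \<in> step {} ^^ j" "(\<one>, h) \<in> step {} ^^ k" by blast
  have "g \<in> carrier G" using eng(1) generates by blast
  then have "(g \<otimes> \<one>, g \<otimes> h) \<in> step {} ^^ k"
    using relpow_translate[OF jk(2), of g "{}"] by auto
  then have "(\<one>, g \<otimes> h) \<in> step {} ^^ (j + k)"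
    using jk(1) \<open>g \<in> carrier G\<close> by (auto simp: relpow_add)
  then show ?case by blast
qed

lemma connected:
  assumes "x \<in> carrier G" and "y \<in> carrier G"
  shows "\<exists>k. (x, y) \<in> step {} ^^ k"
proof -
  obtain k where "(\<one>, inv x \<otimes> y) \<in> step {} ^^ k"
    using connected_one[of "inv x \<otimes> y"] assms generates by auto
  from relpow_translate[OF this, of x "{}"] show ?thesis
    using assms by (auto simp: m_assoc[symmetric])
qed

definition word_dist :: "'a \<Rightarrow> 'a \<Rightarrow> nat" where
  "word_dist x y = (LEAST n. (x, y) \<in> step {} ^^ n)"

lemma word_dist_walk: "x \<in> carrier G \<Longrightarrow> y \<in> carrier G \<Longrightarrow> (x, y) \<in> step {} ^^ word_dist x y"
  unfolding word_dist_def using connected by (rule LeastI_ex)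

lemma word_dist_le: "(x, y) \<in> step {} ^^ n \<Longrightarrow> word_dist x y \<le> n"
  unfolding word_dist_def by (rule Least_le)

lemma word_dist_sym: "word_dist x y = word_dist y x"
  unfolding word_dist_def using relpow_sym[OF step_sym] by metis

lemma word_dist_triangle:
  assumes "x \<in> carrier G" "y \<in> carrier G" "z \<in> carrier G"
  shows "word_dist x z \<le> word_dist x y + word_dist y z"
  using word_dist_walk[of x y] word_dist_walk[of y z] assms by (intro word_dist_le) (auto simp: relpow_add)

lemma word_dist_self [simp]: "word_dist x x = 0"
  using word_dist_le[of x x 0] by auto

lemma word_dist_zero_iff: "x \<in> carrier G \<Longrightarrow> y \<in> carrier G \<Longrightarrow> word_dist x y = 0 \<longleftrightarrow> x = y"
  using word_dist_walk[of x y] by auto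

lemma word_dist_translate:
  assumes "x \<in> carrier G" "y \<in> carrier G" "g \<in> carrier G"
  shows "word_dist (g \<otimes> x) (g \<otimes> y) = word_dist x y"
proof (rule antisym)
  show "word_dist (g \<otimes> x) (g \<otimes> y) \<le> word_dist x y"
    using relpow_translate[OF word_dist_walk, of x y g "{}"] assms by (intro word_dist_le) auto
  have "word_dist (inv g \<otimes> (g \<otimes> x)) (inv g \<otimes> (g \<otimes> y)) \<le> word_dist (g \<otimes> x) (g \<otimes> y)"
    using relpow_translate[OF word_dist_walk, of "g \<otimes> x" "g \<otimes> y" "inv g" "{}"] assms by (intro word_dist_le) auto
  then show "word_dist x y \<le> word_dist (g \<otimes> x) (g \<otimes> y)"
    using assms by (simp add: m_assoc[symmetric])
qed

definition geodesic :: "(nat \<Rightarrow> 'a) \<Rightarrow> 'a \<Rightarrow> 'a \<Rightarrow> bool" where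
  "geodesic \<gamma> x y \<longleftrightarrow> \<gamma> 0 = x \<and> \<gamma> (word_dist x y) = y \<and> (\<forall>i < word_dist x y. (\<gamma> i, \<gamma> (Suc i)) \<in> step {})"

lemma geodesic_exists: "x \<in> carrier G \<Longrightarrow> y \<in> carrier G \<Longrightarrow> \<exists>\<gamma>. geodesic \<gamma> x y"
  using word_dist_walk[of x y] unfolding geodesic_def relpow_fun_conv by blast

lemma geodesic_reverse:
  assumes "geodesic \<gamma> x y"
  shows "geodesic (\<lambda>i. \<gamma> (word_dist x y - i)) y x"
proof -
  have "(\<gamma> (word_dist x y - i), \<gamma> (word_dist x y - Suc i)) \<in> step {}" if "i < word_dist x y" for i
  proof -
    have "(\<gamma> (word_dist x y - Suc i), \<gamma> (Suc (word_dist x y - Suc i))) \<in> step {}"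
      using assms that unfolding geodesic_def by simp
    moreover have "Suc (word_dist x y - Suc i) = word_dist x y - i" using that by simp
    ultimately show ?thesis using step_sym[of "{}"] by (metis symD)
  qed
  then show ?thesis
    using assms unfolding geodesic_def word_dist_sym[of y x] by simp
qed

lemma geodesic_closed:
  assumes "geodesic \<gamma> x y" and "x \<in> carrier G" and "i \<le> word_dist x y"
  shows "\<gamma> i \<in> carrier G"
proof (cases i)
  case (Suc j)
  then have "(\<gamma> j, \<gamma> i) \<in> step {}" using assms unfolding geodesic_def by auto
  then show ?thesis by (auto dest: step_closed)
qed (use assms in \<open>auto simp: geodesic_def\<close>)

lemma word_dist_geodesic:
  assumes \<gamma>: "geodesic \<gamma> x y" and x: "x \<in> carrier G" and ij: "i \<le> j" "j \<le> word_dist x y"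
  shows "word_dist (\<gamma> i) (\<gamma> j) = j - i"
proof -
  have le: "word_dist (\<gamma> k) (\<gamma> l) \<le> l - k" if "k \<le> l" "l \<le> word_dist x y" for k l
  proof -
    have "(\<gamma> k, \<gamma> l) \<in> reach {} (l - k)"
      using \<gamma> that unfolding geodesic_def by (intro reach_path) auto
    then show ?thesis unfolding reach_def using word_dist_le by fastforce
  qed
  have ends: "\<gamma> 0 = x" "\<gamma> (word_dist x y) = y" using \<gamma> unfolding geodesic_def by auto
  have c: "x \<in> carrier G" "\<gamma> i \<in> carrier G" "\<gamma> j \<in> carrier G" "y \<in> carrier G"
    using geodesic_closed[OF \<gamma> x, of i] geodesic_closed[OF \<gamma> x, of j]
      geodesic_closed[OF \<gamma> x, of "word_dist x y"] ij x ends by auto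
  have "word_dist x y \<le> word_dist x (\<gamma> i) + word_dist (\<gamma> i) (\<gamma> j) + word_dist (\<gamma> j) y"
    using word_dist_triangle[OF c(1,2,4)] word_dist_triangle[OF c(2,3,4)] by linarith
  moreover have "word_dist x (\<gamma> i) \<le> i" "word_dist (\<gamma> j) y \<le> word_dist x y - j"
    using le[of 0 i] le[of j "word_dist x y"] ij ends by auto
  ultimately show ?thesis
    using le[OF ij] ij by linarith
qed

lemma word_dist_geodesic_ends:
  assumes "geodesic \<gamma> x y" and "x \<in> carrier G" and "i \<le> word_dist x y"
  shows "word_dist x (\<gamma> i) = i" and "word_dist (\<gamma> i) y = word_dist x y - i"
  using word_dist_geodesic[OF assms(1,2), of 0 i] word_dist_geodesic[OF assms(1,2), of i "word_dist x y"] assms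
  unfolding geodesic_def by auto

text \<open>
  An edge that does not have both ends in \<open>B\<close> is never removed, so a stretch of a geodesic without
  two consecutive vertices in \<open>B\<close> is a walk that avoids \<open>B\<close>.
\<close>

lemma geodesic_reach:
  assumes "geodesic \<gamma> x y" and "i \<le> j" "j \<le> word_dist x y"
    and avoids: "\<And>k. i \<le> k \<Longrightarrow> k < j \<Longrightarrow> \<not> (\<gamma> k \<in> B \<and> \<gamma> (Suc k) \<in> B)"
  shows "(\<gamma> i, \<gamma> j) \<in> reach B (j - i)"
proof (rule reach_path[OF assms(2)])
  fix k assume k: "i \<le> k" "k < j"
  then have "(\<gamma> k, \<gamma> (Suc k)) \<in> step {}"
    using assms(1,3) unfolding geodesic_def by simp
  then show "(\<gamma> k, \<gamma> (Suc k)) \<in> step B"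
    using avoids[OF k] by (rule step_avoiding)
qed

section \<open>Cosets and closest points\<close>

definition cosets :: "'a set set" where
  "cosets = (\<lambda>g. g <# H) ` carrier G"

lemma coset_closed: "B \<in> cosets \<Longrightarrow> B \<subseteq> carrier G"
  unfolding cosets_def using l_coset_subset_G[OF H.subset] by auto

lemma coset_mem: "B \<in> cosets \<Longrightarrow> p \<in> B \<Longrightarrow> p \<in> carrier G"
  using coset_closed by blast

lemma mem_coset_iff:
  assumes "B \<in> cosets" and "p \<in> B" and "x \<in> carrier G"
  shows "x \<in> B \<longleftrightarrow> inv p \<otimes> x \<in> H"
proof -
  obtain g where g: "g \<in> carrier G" "B = g <# H"
    using assms(1) unfolding cosets_def by blast
  obtain h where h: "h \<in> H" "p = g \<otimes> h"
    using assms(2) unfolding g(2) l_coset_def by blast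
  have hc: "h \<in> carrier G" using h by simp
  show ?thesis
  proof
    assume "x \<in> B"
    then obtain k where k: "k \<in> H" "x = g \<otimes> k"
      unfolding g(2) l_coset_def by blast
    have "inv g \<otimes> (g \<otimes> k) = k"
      using g(1) k(1) by (simp add: m_assoc[symmetric])
    then have "inv p \<otimes> x = inv h \<otimes> k"
      unfolding h(2) k(2) using g(1) hc k(1) by (simp add: inv_mult_group m_assoc)
    then show "inv p \<otimes> x \<in> H" using h k by simp
  next
    assume a: "inv p \<otimes> x \<in> H"
    have "x = g \<otimes> (h \<otimes> (inv p \<otimes> x))"
      using g hc assms(3) unfolding h(2) by (simp add: m_assoc[symmetric])
    moreover have "h \<otimes> (inv p \<otimes> x) \<in> H" using a h by simp
    ultimately show "x \<in> B" unfolding g(2) l_coset_def by blast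
  qed
qed

lemma coset_eqI:
  assumes "B \<in> cosets" "C \<in> cosets" "p \<in> B" "p \<in> C"
  shows "B = C"
proof (rule Set.set_eqI)
  fix x
  show "x \<in> B \<longleftrightarrow> x \<in> C"
    using mem_coset_iff[OF assms(1,3), of x] mem_coset_iff[OF assms(2,4), of x]
      coset_mem[OF assms(1), of x] coset_mem[OF assms(2), of x] by argo
qed

lemma self_mem_coset: "g \<in> carrier G \<Longrightarrow> g \<in> g <# H"
  unfolding l_coset_def using H.one_closed by (auto intro!: bexI[of _ \<one>])

lemma coset_nonempty: "B \<in> cosets \<Longrightarrow> B \<noteq> {}"
  unfolding cosets_def using self_mem_coset by blast

lemma H_coset: "H \<in> cosets"
proof -
  have "H = \<one> <# H" using H.subset by (simp add: lcos_mult_one)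
  then show ?thesis unfolding cosets_def by blast
qed

lemma coset_translate:
  assumes "B \<in> cosets" and "g \<in> carrier G"
  shows "g <# B \<in> cosets"
proof -
  obtain k where "k \<in> carrier G" "B = k <# H" using assms(1) unfolding cosets_def by blast
  then show ?thesis
    using assms(2) H.subset unfolding cosets_def by (auto simp: lcos_m_assoc)
qed

lemma coset_diff: "B \<in> cosets \<Longrightarrow> p \<in> B \<Longrightarrow> q \<in> B \<Longrightarrow> inv p \<otimes> q \<in> H"
  using mem_coset_iff coset_mem by blast

lemma word_dist_coset_le: 
  assumes "B \<in> cosets" "p \<in> B" "q \<in> B"
  shows "word_dist p q \<le> 1"
proof (cases "p = q")
  case False
  have c: "p \<in> carrier G" "q \<in> carrier G" using assms coset_mem by auto
  have "inv p \<otimes> q \<in> H" using assms coset_diff by blast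
  moreover have "q = p \<otimes> (inv p \<otimes> q)" using c by (simp add: m_assoc[symmetric])
  moreover have "inv p \<otimes> q \<noteq> \<one>" using c False \<open>q = p \<otimes> (inv p \<otimes> q)\<close> by auto
  ultimately have "(p, q) \<in> step {}"
    using c unfolding step_def by blast
  then show ?thesis using word_dist_le[of p q 1] by auto
qed simp

definition proj :: "'a set \<Rightarrow> 'a \<Rightarrow> 'a set" where
  "proj B x = {b \<in> B. \<forall>b'\<in>B. word_dist x b \<le> word_dist x b'}"

lemma proj_nonempty: "B \<in> cosets \<Longrightarrow> proj B x \<noteq> {}"
proof -
  assume "B \<in> cosets"
  then obtain b where "b \<in> B" using coset_nonempty by blast
  then have "is_arg_min (word_dist x) (\<lambda>b. b \<in> B) (arg_min (word_dist x) (\<lambda>b. b \<in> B))"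
    using arg_min_natI[of "\<lambda>b. b \<in> B" b] arg_min_nat_le[of "\<lambda>b. b \<in> B" _ "word_dist x"]
    by (auto simp: is_arg_min_linorder)
  then show ?thesis unfolding proj_def is_arg_min_linorder by blast
qed

lemma proj_mem: "p \<in> proj B x \<Longrightarrow> p \<in> B"
  and proj_least: "p \<in> proj B x \<Longrightarrow> b \<in> B \<Longrightarrow> word_dist x p \<le> word_dist x b"
  unfolding proj_def by auto

lemma proj_translate:
  assumes "B \<in> cosets" "x \<in> carrier G" "g \<in> carrier G"
  shows "proj (g <# B) (g \<otimes> x) = (\<otimes>) g ` proj B x"
proof -
  have "g <# B = (\<otimes>) g ` B" unfolding l_coset_def by blast
  moreover have "word_dist (g \<otimes> x) (g \<otimes> b) = word_dist x b" if "b \<in> B" for b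
    using word_dist_translate assms that coset_mem by blast
  ultimately show ?thesis
    unfolding proj_def by auto
qed

section \<open>Elements of the subgroup that are small for the relative metric\<close>

text \<open>
  The ball of radius \<open>n\<close> around 1 in the relative metric of \<open>H\<close>; relative distances in other
  cosets are measured after translation to \<open>H\<close>.
\<close>

definition small :: "nat \<Rightarrow> 'a set" where
  "small n = {h \<in> H. (\<one>, h) \<in> reach H n}"

lemma small_H: "h \<in> small n \<Longrightarrow> h \<in> H"
  unfolding small_def by simp

lemma small_mono: "m \<le> n \<Longrightarrow> small m \<subseteq> small n"
  unfolding small_def using reach_mono by blast

lemma H_translate: "h \<in> H \<Longrightarrow> z \<in> carrier G \<Longrightarrow> h \<otimes> z \<in> H \<Longrightarrow> z \<in> H"
  using H.m_closed[of "inv h" "h \<otimes> z"] by (simp add: m_assoc[symmetric])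

lemma small_mult:
  assumes "g \<in> small m" and "h \<in> small n"
  shows "g \<otimes> h \<in> small (m + n)"
proof -
  have g: "g \<in> H" "(\<one>, g) \<in> reach H m" and h: "h \<in> H" "(\<one>, h) \<in> reach H n"
    using assms unfolding small_def by auto
  have "(g \<otimes> \<one>, g \<otimes> h) \<in> reach H n"
  proof (rule reach_translate[OF h(2)])
    show "z \<in> H" if "z \<in> carrier G" "g \<otimes> z \<in> H" for z
      using H_translate[OF g(1) that] .
  qed (use g(1) in simp)
  then show ?thesis
    using reach_trans[OF g(2), of "g \<otimes> h" n] H.m_closed[OF g(1) h(1)] H.mem_carrier[OF g(1)]
    unfolding small_def by (simp only: mem_Collect_eq r_one)
qed

lemma small_inv:
  assumes "h \<in> small n"
  shows "inv h \<in> small n"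
proof -
  have h: "h \<in> H" "(\<one>, h) \<in> reach H n" using assms unfolding small_def by auto
  have "(inv h \<otimes> \<one>, inv h \<otimes> h) \<in> reach H n"
  proof (rule reach_translate[OF h(2)])
    show "z \<in> H" if "z \<in> carrier G" "inv h \<otimes> z \<in> H" for z
      using H_translate[OF H.m_inv_closed[OF h(1)] that] .
  qed (use h(1) in simp)
  then have "(inv h, \<one>) \<in> reach H n" using h(1) by simp
  then show ?thesis
    using reach_sym[of "inv h" \<one> H n] h(1) unfolding small_def by blast
qed

lemma small_diff:
  assumes "B \<in> cosets" "p \<in> B" "q \<in> B" "(p, q) \<in> reach B n"
  shows "inv p \<otimes> q \<in> small n"
proof -
  have c: "p \<in> carrier G" "q \<in> carrier G" using assms coset_mem by auto
  have "(inv p \<otimes> p, inv p \<otimes> q) \<in> reach H n"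
    by (rule reach_translate[OF assms(4)]) (use mem_coset_iff[OF assms(1,2)] c in auto)
  then show ?thesis
    using coset_diff[OF assms(1-3)] c unfolding small_def by simp
qed

text \<open>
  Relative distances may be infinite, so they are only ever bounded and never named.
\<close>

definition close :: "nat \<Rightarrow> 'a set \<Rightarrow> 'a \<Rightarrow> 'a \<Rightarrow> bool" where
  "close n B x y \<longleftrightarrow> (\<forall>p\<in>proj B x. \<forall>q\<in>proj B y. inv p \<otimes> q \<in> small n)"

lemma close_mono: "m \<le> n \<Longrightarrow> close m B x y \<Longrightarrow> close n B x y"
  unfolding close_def using small_mono by blast

lemma close_sym:
  assumes "B \<in> cosets" "close n B x y"
  shows "close n B y x"
  unfolding close_def
proof (intro ballI)
  fix p q assume pq: "p \<in> proj B y" "q \<in> proj B x"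
  then have "p \<in> carrier G" "q \<in> carrier G" using proj_mem coset_mem[OF assms(1)] by blast+
  then have "inv p \<otimes> q = inv (inv q \<otimes> p)" by (simp add: inv_mult_group)
  moreover have "inv q \<otimes> p \<in> small n" using pq assms(2) unfolding close_def by blast
  ultimately show "inv p \<otimes> q \<in> small n" using small_inv by simp
qed

lemma small_diff_trans:
  assumes "p \<in> carrier G" "q \<in> carrier G" "r \<in> carrier G"
    and "inv p \<otimes> q \<in> small m" "inv q \<otimes> r \<in> small n"
  shows "inv p \<otimes> r \<in> small (m + n)"
proof -
  have "inv p \<otimes> r = (inv p \<otimes> q) \<otimes> (inv q \<otimes> r)"
    using assms(1-3) by (simp add: m_assoc) (simp add: m_assoc[symmetric])
  then show ?thesis using small_mult[OF assms(4,5)] by simp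
qed

lemma close_trans:
  assumes "B \<in> cosets" "close m B x y" "close n B y z"
  shows "close (m + n) B x z"
  unfolding close_def
proof (intro ballI)
  fix p q assume pq: "p \<in> proj B x" "q \<in> proj B z"
  obtain r where r: "r \<in> proj B y" using proj_nonempty[OF assms(1)] by blast
  show "inv p \<otimes> q \<in> small (m + n)"
    using small_diff_trans[of p r q m n] pq r assms proj_mem coset_mem unfolding close_def by blast
qed

end

section \<open>Projections to cosets in a hyperbolic relative Cayley graph\<close>

text \<open>
  The four-point inequality is Gromov's condition for the vertices, with the denominators
  cleared and an integral constant.
\<close>

locale hyperbolic_pair = relative_cayley +
  fixes \<delta> :: nat
  assumes four_point: "\<lbrakk>x \<in> carrier G; y \<in> carrier G; z \<in> carrier G; w \<in> carrier G\<rbrakk> \<Longrightarrow>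
      word_dist x z + word_dist y w \<le> max (word_dist x y + word_dist z w) (word_dist y z + word_dist x w) + 2 * \<delta>"
    and finite_small: "finite (small n)"
begin

text \<open>
  A point that is almost on a geodesic metrically is close to one: the four-point condition
  compares \<open>m\<close> with the point of \<open>\<gamma>\<close> at the same distance from \<open>a\<close>.
\<close>

lemma near_geodesic:
  assumes "geodesic \<gamma> a b" and c: "a \<in> carrier G" "b \<in> carrier G" "m \<in> carrier G"
    and almost: "word_dist m a + word_dist m b \<le> word_dist a b + k"
  shows "\<exists>i\<le>word_dist a b. word_dist m (\<gamma> i) \<le> k + 2 * \<delta>"
proof (cases "word_dist m a \<le> word_dist a b")
  case True
  define i where "i = word_dist m a"
  have i: "word_dist a (\<gamma> i) = i" "word_dist (\<gamma> i) b = word_dist a b - i" "\<gamma> i \<in> carrier G"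
    using word_dist_geodesic_ends[OF assms(1) c(1), of i] geodesic_closed[OF assms(1) c(1), of i] True
    unfolding i_def by auto
  have "word_dist m (\<gamma> i) + word_dist a b \<le> max (word_dist m a + word_dist (\<gamma> i) b) (word_dist a (\<gamma> i) + word_dist m b) + 2 * \<delta>"
    using four_point[of m a "\<gamma> i" b] c i by blast
  also have "\<dots> \<le> word_dist a b + k + 2 * \<delta>"
    using almost i True unfolding i_def by auto
  finally have "word_dist m (\<gamma> i) \<le> k + 2 * \<delta>" by simp
  then show ?thesis using True unfolding i_def by blast
next
  case False
  then have "word_dist m b \<le> k" using almost by linarith
  then show ?thesis
    using assms(1) unfolding geodesic_def by (intro exI[of _ "word_dist a b"]) auto
qed

text \<open>
  The constant \<open>\<tau>\<close> bounds the length of the jumps between the sides of a quadrilateral with one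
  side of length at most 1.  A path of length \<open>\<tau>\<close> that starts at distance \<open>R\<close> from a coset
  cannot meet the coset.
\<close>

definition \<tau> :: nat where "\<tau> = 4 * \<delta> + 2"

definition R :: nat where "R = \<tau> + 1"

lemma reach_far_from_coset:
  assumes "B \<in> cosets" "m \<in> carrier G" "u \<in> carrier G"
    and "word_dist m u \<le> n" and far: "\<And>b. b \<in> B \<Longrightarrow> n < word_dist m b"
  shows "(m, u) \<in> reach B n"
proof -
  obtain \<gamma> where \<gamma>: "geodesic \<gamma> m u" using geodesic_exists assms by blast
  have "\<gamma> i \<notin> B" if "i \<le> word_dist m u" for i
    using far[of "\<gamma> i"] word_dist_geodesic_ends(1)[OF \<gamma> assms(2) that] assms(4) that by auto
  then have "(\<gamma> 0, \<gamma> (word_dist m u)) \<in> reach B (word_dist m u - 0)"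
    by (intro geodesic_reach[OF \<gamma>]) auto
  then show ?thesis
    using \<gamma> reach_mono[OF assms(4), of B] unfolding geodesic_def by auto
qed

text \<open>
  A geodesic that starts at a closest point \<open>p\<close> of \<open>B\<close> moves away from \<open>B\<close> at unit speed, so it
  meets \<open>B\<close> only in \<open>p\<close>.
\<close>

lemma descent_from_projection:
  assumes B: "B \<in> cosets" and x: "x \<in> carrier G" and p: "p \<in> proj B x"
    and \<alpha>: "geodesic \<alpha> p x" and i: "i \<le> word_dist p x"
  shows "b \<in> B \<Longrightarrow> i \<le> word_dist (\<alpha> i) b" and "(p, \<alpha> i) \<in> reach B i"
proof -
  have pc: "p \<in> carrier G" using p proj_mem coset_mem[OF B] by blast
  have far: "j \<le> word_dist (\<alpha> j) b" if "b \<in> B" "j \<le> word_dist p x" for b j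
  proof -
    have "word_dist x p \<le> word_dist x b" using proj_least[OF p that(1)] .
    also have "\<dots> \<le> word_dist x (\<alpha> j) + word_dist (\<alpha> j) b"
      using word_dist_triangle x geodesic_closed[OF \<alpha> pc that(2)] coset_mem[OF B that(1)] by blast
    finally show ?thesis
      using word_dist_geodesic_ends(2)[OF \<alpha> pc that(2)] that(2) word_dist_sym[of x p] word_dist_sym[of x "\<alpha> j"] by linarith
  qed
  then show "b \<in> B \<Longrightarrow> i \<le> word_dist (\<alpha> i) b" using i by blast
  have "\<alpha> (Suc j) \<notin> B" if "j < i" for j
    using far[of "\<alpha> (Suc j)" "Suc j"] that i by fastforce
  then have "(\<alpha> 0, \<alpha> i) \<in> reach B (i - 0)"
    using i by (intro geodesic_reach[OF \<alpha>]) auto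
  then show "(p, \<alpha> i) \<in> reach B i"
    using \<alpha> unfolding geodesic_def by simp
qed

text \<open>
  In the quadrilateral \<open>p, x, y, q\<close>, walk from \<open>p\<close> towards \<open>x\<close> until the distance from \<open>B\<close> is
  \<open>R\<close>.  From there a jump of length \<open>\<tau>\<close> leads to \<open>[x, y]\<close> or to \<open>[q, y]\<close>, and it is too short to
  meet \<open>B\<close>.  In the second case it ends near \<open>q\<close>, which is reached by walking down to \<open>B\<close>.
\<close>

lemma detour_from_projection:
  assumes B: "B \<in> cosets" and c: "x \<in> carrier G" "y \<in> carrier G"
    and p: "p \<in> proj B x" and q: "q \<in> proj B y" and \<gamma>: "geodesic \<gamma> x y"
  shows "(\<exists>i\<le>word_dist x y. (p, \<gamma> i) \<in> reach B (R + \<tau>)) \<or> (p, q) \<in> reach B (2 * (R + \<tau>) + 1)"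
proof -
  have pB: "p \<in> B" "q \<in> B" using p q proj_mem by auto
  then have pc: "p \<in> carrier G" "q \<in> carrier G" using coset_mem[OF B] by auto
  obtain \<alpha> where \<alpha>: "geodesic \<alpha> p x" using geodesic_exists pc c by blast
  obtain \<beta> where \<beta>: "geodesic \<beta> q y" using geodesic_exists pc c by blast
  show ?thesis
  proof (cases "word_dist p x \<le> R")
    case True
    have "(p, \<alpha> (word_dist p x)) \<in> reach B (word_dist p x)"
      using descent_from_projection(2)[OF B c(1) p \<alpha>] by blast
    then have "(p, \<gamma> 0) \<in> reach B (R + \<tau>)"
      using \<alpha> \<gamma> reach_mono[of "word_dist p x" "R + \<tau>" B] True unfolding geodesic_def by auto
    then show ?thesis by blast
  next
    case False
    define m where "m = \<alpha> R"
    have m: "m \<in> carrier G" "word_dist m p = R" "word_dist m x = word_dist p x - R"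
      using geodesic_closed[OF \<alpha> pc(1), of R] word_dist_geodesic_ends[OF \<alpha> pc(1), of R] False word_dist_sym[of m p]
      unfolding m_def by auto
    have far: "\<tau> < word_dist m b" if "b \<in> B" for b
      using descent_from_projection(1)[OF B c(1) p \<alpha> _ that, of R] False unfolding m_def R_def by simp
    have pm: "(p, m) \<in> reach B R"
      using descent_from_projection(2)[OF B c(1) p \<alpha>, of R] False unfolding m_def by simp
    \<comment> \<open>The four-point condition decides near which of the other sides the point \<open>m\<close> lies.\<close>
    have "word_dist m y + word_dist p x \<le> max (word_dist m p + word_dist y x) (word_dist p y + word_dist m x) + 2 * \<delta>"
      using four_point[of m p y x] c pc m by blast
    then consider "word_dist m y + word_dist p x \<le> word_dist m p + word_dist y x + 2 * \<delta>"
      | "word_dist m y + word_dist p x \<le> word_dist p y + word_dist m x + 2 * \<delta>" by linarith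
    then show ?thesis
    proof cases
      case 1
      then have "word_dist m x + word_dist m y \<le> word_dist x y + 2 * \<delta>"
        using m False word_dist_sym[of x y] by linarith
      then obtain i where i: "i \<le> word_dist x y" "word_dist m (\<gamma> i) \<le> \<tau>"
        using near_geodesic[OF \<gamma> c m(1), of "2 * \<delta>"] unfolding \<tau>_def by auto
      then have "(m, \<gamma> i) \<in> reach B \<tau>"
        using reach_far_from_coset[OF B m(1) geodesic_closed[OF \<gamma> c(1)] _ far] by blast
      then show ?thesis
        using reach_trans[OF pm] i by blast
    next
      case 2
      have "word_dist p y \<le> word_dist p q + word_dist q y" "word_dist m q \<le> word_dist m p + word_dist p q" "word_dist p q \<le> 1"
        using word_dist_triangle pc c m word_dist_coset_le[OF B pB] by blast+
      then have "word_dist m q + word_dist m y \<le> word_dist q y + (2 * \<delta> + 2)"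
        using 2 m False by linarith
      then obtain j where j: "j \<le> word_dist q y" "word_dist m (\<beta> j) \<le> \<tau>"
        using near_geodesic[OF \<beta> pc(2) c(2) m(1), of "2 * \<delta> + 2"] unfolding \<tau>_def by auto
      have bc: "\<beta> j \<in> carrier G" using geodesic_closed[OF \<beta> pc(2) j(1)] .
      have "(m, \<beta> j) \<in> reach B \<tau>"
        using reach_far_from_coset[OF B m(1) bc j(2) far] by blast
      then have pj: "(p, \<beta> j) \<in> reach B (R + \<tau>)"
        using reach_trans[OF pm] by blast
      have "word_dist q (\<beta> j) \<le> word_dist q m + word_dist m (\<beta> j)" "word_dist q m \<le> word_dist q p + word_dist p m"
        using word_dist_triangle pc m(1) bc by blast+
      then have "j \<le> R + \<tau> + 1"
        using word_dist_geodesic_ends(1)[OF \<beta> pc(2) j(1)] j(2) m(2) word_dist_sym[of m p] word_dist_sym[of q p] \<open>word_dist p q \<le> 1\<close>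
        by linarith
      then have "(\<beta> j, q) \<in> reach B (R + \<tau> + 1)"
        using descent_from_projection(2)[OF B c(2) q \<beta> j(1)] reach_sym reach_mono by blast
      then have "(p, q) \<in> reach B ((R + \<tau>) + (R + \<tau> + 1))"
        by (rule reach_trans[OF pj])
      moreover have "(R + \<tau>) + (R + \<tau> + 1) = 2 * (R + \<tau>) + 1" by simp
      ultimately have "(p, q) \<in> reach B (2 * (R + \<tau>) + 1)" by (simp only:)
      then show ?thesis ..
    qed
  qed
qed

text \<open>
  The length of a detour from \<open>p\<close> to \<open>q\<close> by way of \<open>[x, y]\<close>: two pieces of length \<open>R + \<tau>\<close>, and a
  piece of \<open>[x, y]\<close> whose ends are joined by these two and an edge.
\<close>

definition D :: nat where "D = 4 * (R + \<tau>) + 1"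

text \<open>
  If the geodesic has no two consecutive vertices in \<open>B\<close>, then a piece of it together with the
  detours from its two ends joins \<open>p\<close> to \<open>q\<close> by a short path that avoids the edges of \<open>B\<close>.
\<close>

lemma geodesic_through_coset:
  assumes B: "B \<in> cosets" and c: "x \<in> carrier G" "y \<in> carrier G"
    and \<gamma>: "geodesic \<gamma> x y" and far: "\<not> close D B x y"
  shows "\<exists>i<word_dist x y. \<gamma> i \<in> B \<and> \<gamma> (Suc i) \<in> B"
proof (rule ccontr)
  assume none: "\<not> ?thesis"
  obtain p q where p: "p \<in> proj B x" and q: "q \<in> proj B y" and pq: "inv p \<otimes> q \<notin> small D"
    using far unfolding close_def by blast
  have pB: "p \<in> B" "q \<in> B" using p q proj_mem by auto
  then have pc: "p \<in> carrier G" "q \<in> carrier G" using coset_mem[OF B] by auto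
  have no: "(p, q) \<notin> reach B D"
    using small_diff[OF B pB] pq by blast
  then have no': "(p, q) \<notin> reach B (2 * (R + \<tau>) + 1)"
    using reach_mono[of "2 * (R + \<tau>) + 1" D B] unfolding D_def by auto
  obtain i where i: "i \<le> word_dist x y" "(p, \<gamma> i) \<in> reach B (R + \<tau>)"
    using detour_from_projection[OF B c p q \<gamma>] no' by blast
  obtain j where j: "j \<le> word_dist x y" "(q, \<gamma> j) \<in> reach B (R + \<tau>)"
    using detour_from_projection[OF B c(2,1) q p geodesic_reverse[OF \<gamma>]] no' reach_sym word_dist_sym[of y x]
    by (metis diff_le_self)
  have along: "(\<gamma> k, \<gamma> l) \<in> reach B (2 * (R + \<tau>) + 1)"
    if kl: "k \<le> l" "l \<le> word_dist x y" "word_dist (\<gamma> k) (\<gamma> l) \<le> 2 * (R + \<tau>) + 1" for k l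
  proof -
    have "(\<gamma> k, \<gamma> l) \<in> reach B (l - k)"
      using none kl by (intro geodesic_reach[OF \<gamma>]) auto
    moreover have "l - k \<le> 2 * (R + \<tau>) + 1"
      using word_dist_geodesic[OF \<gamma> c(1) kl(1,2)] kl(3) by simp
    ultimately show ?thesis using reach_mono by blast
  qed
  have short: "word_dist u v \<le> n" if "(u, v) \<in> reach B n" for u v n
  proof -
    have "step B ^^ k \<subseteq> step {} ^^ k" for k
      by (rule relpow_subset) (auto simp: step_def)
    then show ?thesis using that word_dist_le unfolding reach_def by fastforce
  qed
  have gc: "\<gamma> i \<in> carrier G" "\<gamma> j \<in> carrier G" using geodesic_closed[OF \<gamma> c(1)] i j by auto
  have "word_dist (\<gamma> i) (\<gamma> j) \<le> word_dist (\<gamma> i) p + word_dist p (\<gamma> j)" "word_dist p (\<gamma> j) \<le> word_dist p q + word_dist q (\<gamma> j)"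
    using word_dist_triangle gc pc by blast+
  then have "word_dist (\<gamma> i) (\<gamma> j) \<le> 2 * (R + \<tau>) + 1"
    using short[OF i(2)] short[OF j(2)] word_dist_coset_le[OF B pB] word_dist_sym[of "\<gamma> i" p]
    unfolding mult_2 by linarith
  then have "(\<gamma> i, \<gamma> j) \<in> reach B (2 * (R + \<tau>) + 1)"
    using along[of i j] along[of j i] reach_sym[of "\<gamma> j" "\<gamma> i"] i j word_dist_sym[of "\<gamma> i" "\<gamma> j"]
    by (cases "i \<le> j") auto
  then have "(p, q) \<in> reach B ((R + \<tau>) + (2 * (R + \<tau>) + 1) + (R + \<tau>))"
    using reach_trans[OF reach_trans[OF i(2)] reach_sym[OF j(2)]] by blast
  then show False using no unfolding D_def by (simp add: algebra_simps)
qed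

lemma far_passes_through:
  assumes "B \<in> cosets" "x \<in> carrier G" "y \<in> carrier G" "\<not> close D B x y"
  shows "\<exists>u\<in>B. \<exists>v\<in>B. word_dist x y = word_dist x u + 1 + word_dist v y"
proof -
  obtain \<gamma> where \<gamma>: "geodesic \<gamma> x y" using geodesic_exists assms by blast
  obtain i where i: "i < word_dist x y" "\<gamma> i \<in> B" "\<gamma> (Suc i) \<in> B"
    using geodesic_through_coset[OF assms(1-3) \<gamma> assms(4)] by blast
  have "word_dist x y = word_dist x (\<gamma> i) + 1 + word_dist (\<gamma> (Suc i)) y"
    using word_dist_geodesic_ends(1)[OF \<gamma> assms(2), of i] word_dist_geodesic_ends(2)[OF \<gamma> assms(2), of "Suc i"] i(1)
    by simp
  then show ?thesis using i by blast
qed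

text \<open>
  A geodesic of length 0 has no edges.
\<close>

lemma close_self:
  assumes "B \<in> cosets" "x \<in> carrier G"
  shows "close D B x x"
  using far_passes_through[OF assms assms(2)] by force

text \<open>
  Two points of \<open>C\<close> are joined by an edge, and an edge of \<open>B\<close> would make \<open>B\<close> and \<open>C\<close> meet.
\<close>

lemma close_on_other_coset:
  assumes "B \<in> cosets" "C \<in> cosets" "B \<noteq> C" "x \<in> C" "y \<in> C"
  shows "close D B x y"
proof (rule ccontr)
  assume far: "\<not> close D B x y"
  have c: "x \<in> carrier G" "y \<in> carrier G" using assms coset_mem by auto
  obtain u v where uv: "u \<in> B" "v \<in> B" "word_dist x y = word_dist x u + 1 + word_dist v y"
    using far_passes_through[OF assms(1) c far] by blast
  then have "word_dist x u = 0" using word_dist_coset_le[OF assms(2,4,5)] by linarith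
  then have "x = u" using word_dist_zero_iff c coset_mem[OF assms(1) uv(1)] by blast
  then show False using coset_eqI[OF assms(1,2), of x] uv(1) assms by blast
qed

text \<open>
  If \<open>C\<close> and \<open>x\<close> project far apart on \<open>B\<close>, then the geodesic from \<open>x\<close> to a closest point \<open>c'\<close> of
  \<open>C\<close> passes through a point \<open>u\<close> of \<open>B\<close>.  The point \<open>c'\<close> is also closest to \<open>u\<close>, so \<open>x\<close> and
  \<open>B\<close> have nearby projections to \<open>C\<close>.
\<close>

lemma behrstock:
  assumes "B \<in> cosets" "C \<in> cosets" "B \<noteq> C" "b \<in> B" "c \<in> C" "x \<in> carrier G"
  shows "close (3 * D) B c x \<or> close (3 * D) C b x"
proof -
  obtain c' where c': "c' \<in> proj C x" using proj_nonempty[OF assms(2)] by blast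
  then have c'C: "c' \<in> C" by (rule proj_mem)
  have cc: "c' \<in> carrier G" using coset_mem[OF assms(2) c'C] .
  show ?thesis
  proof (cases "close D B c' x")
    case True
    then have "close (D + D) B c x"
      using close_trans[OF assms(1) close_on_other_coset[OF assms(1,2,3,5) c'C]] by blast
    then show ?thesis using close_mono[of "D + D" "3 * D"] by simp
  next
    case False
    then have "\<not> close D B x c'" using close_sym[OF assms(1)] by blast
    then obtain u v where uv: "u \<in> B" "v \<in> B" "word_dist x c' = word_dist x u + 1 + word_dist v c'"
      using far_passes_through[OF assms(1,6) cc] by blast
    have uvc: "u \<in> carrier G" "v \<in> carrier G" using uv coset_mem[OF assms(1)] by auto
    have "word_dist u c' \<le> word_dist u c''" if "c'' \<in> C" for c''
    proof -
      have "word_dist u c' \<le> word_dist u v + word_dist v c'" using word_dist_triangle uvc cc by blast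
      moreover have "word_dist u v \<le> 1" using word_dist_coset_le[OF assms(1) uv(1,2)] .
      moreover have "word_dist x c' \<le> word_dist x c''" using proj_least[OF c' that] .
      moreover have "word_dist x c'' \<le> word_dist x u + word_dist u c''"
        using word_dist_triangle assms(6) uvc coset_mem[OF assms(2) that] by blast
      ultimately show ?thesis using uv(3) by linarith
    qed
    then have c'u: "c' \<in> proj C u" unfolding proj_def using c'C by blast
    have "close (D + D) C u x"
      unfolding close_def
    proof (intro ballI)
      fix p q assume pq: "p \<in> proj C u" "q \<in> proj C x"
      have "inv p \<otimes> c' \<in> small D" "inv c' \<otimes> q \<in> small D"
        using close_self[OF assms(2) uvc(1)] close_self[OF assms(2,6)] pq c' c'u unfolding close_def by blast+
      moreover have "p \<in> carrier G" "q \<in> carrier G"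
        using coset_mem[OF assms(2) proj_mem[OF pq(1)]] coset_mem[OF assms(2) proj_mem[OF pq(2)]] .
      ultimately show "inv p \<otimes> q \<in> small (D + D)"
        using small_diff_trans[of p c' q D D] cc by blast
    qed
    then have "close (D + (D + D)) C b x"
      using close_trans[OF assms(2) close_on_other_coset[OF assms(2,1) _ assms(4) uv(1)]] assms(3) by blast
    then show ?thesis by (simp add: mult.commute[of 3] numeral_3_eq_3)
  qed
qed

definition gate :: "'a set \<Rightarrow> 'a set \<Rightarrow> 'a set" where
  "gate B C = {b \<in> B. \<exists>c\<in>C. \<forall>b'\<in>B. \<forall>c'\<in>C. word_dist c b \<le> word_dist c' b'}"

text \<open>
  Every geodesic from \<open>y\<close> to \<open>B\<close> runs along an edge of \<open>C\<close>, and \<open>C\<close> can be left at any of its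
  points for the same price.  So the points of \<open>B\<close> closest to \<open>y\<close> are those closest to \<open>C\<close>,
  whatever \<open>y\<close> is.
\<close>

lemma proj_eq_gate:
  assumes B: "B \<in> cosets" and C: "C \<in> cosets" and "B \<noteq> C" and "b0 \<in> B" and y: "y \<in> carrier G"
    and far: "\<not> close (2 * D) C b0 y"
  shows "proj B y = gate B C"
proof -
  \<comment> \<open>All points of \<open>B\<close> have projections to \<open>C\<close> near that of \<open>b0\<close>, so \<open>C\<close> lies between \<open>y\<close> and every \<open>b\<close>.\<close>
  have through: "\<exists>u\<in>C. \<exists>v\<in>C. word_dist y b = word_dist y u + 1 + word_dist v b" if "b \<in> B" for b
  proof -
    have "\<not> close D C y b"
    proof
      assume "close D C y b"
      then have "close (D + D) C b0 y"
        using close_trans[OF C close_on_other_coset[OF C B _ assms(4) that] close_sym[OF C]] assms(3) by blast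
      then show False using far by (simp add: mult_2)
    qed
    then show ?thesis using far_passes_through[OF C y coset_mem[OF B that]] by blast
  qed
  show ?thesis
  proof
    show "proj B y \<subseteq> gate B C"
    proof
      fix b assume b: "b \<in> proj B y"
      obtain u v where uv: "u \<in> C" "v \<in> C" "word_dist y b = word_dist y u + 1 + word_dist v b"
        using through[OF proj_mem[OF b]] by blast
      have "word_dist v b \<le> word_dist c' b'" if "b' \<in> B" "c' \<in> C" for b' c'
      proof -
        have "word_dist y b \<le> word_dist y b'" using proj_least[OF b that(1)] .
        moreover have "word_dist y b' \<le> word_dist y u + word_dist u b'" "word_dist u b' \<le> word_dist u c' + word_dist c' b'"
          using word_dist_triangle y coset_mem[OF C] coset_mem[OF B] uv that by blast+
        moreover have "word_dist u c' \<le> 1" using word_dist_coset_le[OF C uv(1) that(2)] .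
        ultimately show ?thesis using uv(3) by linarith
      qed
      then show "b \<in> gate B C" unfolding gate_def using uv(2) proj_mem[OF b] by blast
    qed
    show "gate B C \<subseteq> proj B y"
    proof
      fix b assume "b \<in> gate B C"
      then obtain c where b: "b \<in> B" "c \<in> C" "\<And>b' c'. b' \<in> B \<Longrightarrow> c' \<in> C \<Longrightarrow> word_dist c b \<le> word_dist c' b'"
        unfolding gate_def by blast
      have "word_dist y b \<le> word_dist y b'" if b': "b' \<in> B" for b'
      proof -
        obtain u v where uv: "u \<in> C" "v \<in> C" "word_dist y b' = word_dist y u + 1 + word_dist v b'"
          using through[OF b'] by blast
        have "word_dist y b \<le> word_dist y u + word_dist u b" "word_dist u b \<le> word_dist u c + word_dist c b"
          using word_dist_triangle y coset_mem[OF C] coset_mem[OF B] uv b b' by blast+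
        moreover have "word_dist u c \<le> 1" using word_dist_coset_le[OF C uv(1) b(2)] .
        moreover have "word_dist c b \<le> word_dist v b'" using b(3)[OF b' uv(2)] .
        ultimately show ?thesis using uv(3) by linarith
      qed
      then show "b \<in> proj B y" unfolding proj_def using b(1) by blast
    qed
  qed
qed

end

section \<open>Chains carried by a coset\<close>

context hyperbolic_pair
begin

sublocale K: group "G\<lparr>carrier := H\<rparr>"
  by (rule H.subgroup_is_group[OF group_axioms])

abbreviation filled_H :: "nat \<Rightarrow> ('a \<Rightarrow> int) set" where
  "filled_H \<equiv> K.filled (small (12 * D))"

text \<open>
  Chains that change sign under inversion make the contribution of a pair of points
  antisymmetric, which the cancellation in triangles needs.
\<close>

definition antisym :: "'a \<Rightarrow> 'a \<Rightarrow> int" where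
  "antisym h = single h - single (inv h)"

lemma triangle_filled_H:
  assumes "a \<in> H" "b \<in> H"
  shows "single a + single b - single (a \<otimes> b) \<in> filled_H 1"
  using K.triangle_filled[of a b "small (12 * D)"] assms by (simp only: K.triangle_def) simp

lemma antisym_inv: "a \<in> H \<Longrightarrow> antisym (inv a) = - antisym a"
  unfolding antisym_def by simp

lemma antisym_mult:
  assumes "a \<in> H" "b \<in> H"
  shows "antisym a + antisym b - antisym (a \<otimes> b) \<in> filled_H 2"
proof -
  have "antisym a + antisym b - antisym (a \<otimes> b) = (single a + single b - single (a \<otimes> b)) -
      (single (inv b) + single (inv a) - single (inv b \<otimes> inv a))"
    unfolding antisym_def using assms by (simp add: inv_mult_group algebra_simps)
  also have "\<dots> \<in> filled_H (1 + 1)"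
    using assms by (intro K.filled_diff triangle_filled_H) auto
  finally show ?thesis by (simp only: one_add_one)
qed

lemma antisym_small:
  assumes "s \<in> small (12 * D)"
  shows "antisym s \<in> filled_H 2"
proof -
  have "antisym s \<in> filled_H (1 + 1)"
    unfolding antisym_def using assms small_inv by (intro K.filled_diff K.single_filled)
  then show ?thesis by (simp only: one_add_one)
qed

lemma antisym_near:
  assumes "s \<in> small (12 * D)" "a \<in> H" "t \<in> small (12 * D)"
  shows "antisym (s \<otimes> (a \<otimes> t)) - antisym a \<in> filled_H 8"
proof -
  have st: "s \<in> H" "t \<in> H" using assms small_H by auto
  have "antisym (s \<otimes> (a \<otimes> t)) - antisym a = (antisym s + antisym t) -
      ((antisym s + antisym (a \<otimes> t) - antisym (s \<otimes> (a \<otimes> t))) + (antisym a + antisym t - antisym (a \<otimes> t)))"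
    by (simp add: algebra_simps)
  also have "\<dots> \<in> filled_H ((2 + 2) + (2 + 2))"
    using assms st by (intro K.filled_diff K.filled_add antisym_small antisym_mult) auto
  finally show ?thesis by simp
qed

lemma antisym_single:
  assumes "h \<in> H"
  shows "antisym h - of_nat 2 * single h \<in> filled_H 2"
proof -
  \<comment> \<open>The chain of the identity is a triangle.\<close>
  have one: "single \<one> = single \<one> + single \<one> - single (\<one> \<otimes> \<one>)" by simp
  have "antisym h - of_nat 2 * single h =
      - ((single h + single (inv h) - single (h \<otimes> inv h)) + single \<one>)"
    unfolding antisym_def using assms by (simp add: algebra_simps)
  also have "\<dots> \<in> filled_H (1 + 1)"
    by (subst one, intro K.filled_uminus K.filled_add triangle_filled_H) (use assms in auto)
  finally show ?thesis by (simp only: one_add_one)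
qed

text \<open>
  A common multiple of the cardinalities of all projections, so that averages over projections
  have integral coefficients after multiplication by it.
\<close>

definition denominator :: nat where "denominator = fact (card (small D))"

definition weight :: "'a set \<Rightarrow> 'a \<Rightarrow> nat" where
  "weight B x = denominator div card (proj B x)"

text \<open>
  By \<open>close_self\<close> the quotients of the points of a projection by one of them are small.
\<close>

lemma proj_finite_card:
  assumes "B \<in> cosets" "x \<in> carrier G"
  shows "finite (proj B x)" and "card (proj B x) \<le> card (small D)"
proof -
  obtain p where p: "p \<in> proj B x" using proj_nonempty[OF assms(1)] by blast
  have c: "q \<in> carrier G" if "q \<in> proj B x" for q
    using that proj_mem coset_mem[OF assms(1)] by blast
  have inj: "inj_on ((\<otimes>) (inv p)) (proj B x)"
    using c p by (intro inj_onI) auto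
  have sub: "(\<otimes>) (inv p) ` proj B x \<subseteq> small D"
    using close_self[OF assms] p unfolding close_def by blast
  show "finite (proj B x)" "card (proj B x) \<le> card (small D)"
    using inj_on_finite[OF inj sub finite_small] card_inj_on_le[OF inj sub finite_small] by auto
qed

lemma sum_weight:
  assumes "B \<in> cosets" "x \<in> carrier G"
  shows "(\<Sum>p\<in>proj B x. weight B x) = denominator"
proof -
  have "1 \<le> card (proj B x)"
    using proj_finite_card(1)[OF assms] proj_nonempty[OF assms(1), of x]
    by (simp add: Suc_le_eq card_gt_0_iff)
  then have "card (proj B x) dvd denominator"
    unfolding denominator_def using proj_finite_card(2)[OF assms] by (rule dvd_fact)
  then show ?thesis unfolding weight_def by simp
qed

definition coset_chain :: "'a set \<Rightarrow> 'a \<Rightarrow> 'a \<Rightarrow> 'a \<Rightarrow> int" where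
  "coset_chain B x y = (\<Sum>p\<in>proj B x. \<Sum>q\<in>proj B y. of_nat (weight B x * weight B y) * antisym (inv p \<otimes> q))"

lemma coset_chain_swap:
  assumes B: "B \<in> cosets"
  shows "coset_chain B y x = - coset_chain B x y"
proof -
  have "of_nat (weight B y * weight B x) * antisym (inv q \<otimes> p) =
      - (of_nat (weight B x * weight B y) * antisym (inv p \<otimes> q))"
    if "p \<in> proj B x" "q \<in> proj B y" for p q
  proof -
    have pq: "p \<in> B" "q \<in> B" using that proj_mem by auto
    then have "inv q \<otimes> p = inv (inv p \<otimes> q)"
      using coset_mem[OF B] by (simp add: inv_mult_group)
    then have "antisym (inv q \<otimes> p) = - antisym (inv p \<otimes> q)"
      using antisym_inv coset_diff[OF B pq] by simp
    then show ?thesis by (simp only: mult.commute[of "weight B y"] mult_minus_right)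
  qed
  then have "(\<Sum>q\<in>proj B y. \<Sum>p\<in>proj B x. of_nat (weight B y * weight B x) * antisym (inv q \<otimes> p)) =
      (\<Sum>q\<in>proj B y. \<Sum>p\<in>proj B x. - (of_nat (weight B x * weight B y) * antisym (inv p \<otimes> q)))"
    by (intro sum.cong refl) blast
  also have "\<dots> = - (\<Sum>q\<in>proj B y. \<Sum>p\<in>proj B x. of_nat (weight B x * weight B y) * antisym (inv p \<otimes> q))"
    by (simp only: sum_negf)
  also have "\<dots> = - coset_chain B x y"
    unfolding coset_chain_def by (subst sum.swap) (rule refl)
  finally show ?thesis unfolding coset_chain_def .
qed

text \<open>
  All points of a projection differ by small elements, so the average may be replaced by the
  term of any single pair of points.
\<close>

lemma coset_chain_approx:
  assumes B: "B \<in> cosets" and c: "x \<in> carrier G" "y \<in> carrier G"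
    and p: "p \<in> proj B x" and q: "q \<in> proj B y"
  shows "coset_chain B x y - of_nat (denominator * denominator) * antisym (inv p \<otimes> q) \<in> filled_H (8 * (denominator * denominator))"
proof -
  let ?W = "weight B x * weight B y"
  have total: "(\<Sum>p'\<in>proj B x. \<Sum>q'\<in>proj B y. ?W) = denominator * denominator"
    using sum_product[of "\<lambda>_. weight B x" "proj B x" "\<lambda>_. weight B y" "proj B y"]
    unfolding sum_weight[OF B c(1)] sum_weight[OF B c(2)] by (rule sym)
  have "of_nat (denominator * denominator) * antisym (inv p \<otimes> q) =
      (\<Sum>p'\<in>proj B x. \<Sum>q'\<in>proj B y. of_nat ?W * antisym (inv p \<otimes> q))"
    by (simp only: total[symmetric] of_nat_sum sum_distrib_right)
  then have "coset_chain B x y - of_nat (denominator * denominator) * antisym (inv p \<otimes> q) =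
      (\<Sum>p'\<in>proj B x. \<Sum>q'\<in>proj B y. of_nat ?W * (antisym (inv p' \<otimes> q') - antisym (inv p \<otimes> q)))"
    unfolding coset_chain_def by (simp only: sum_subtractf[symmetric] right_diff_distrib)
  also have "\<dots> \<in> filled_H (\<Sum>p'\<in>proj B x. \<Sum>q'\<in>proj B y. ?W * 8)"
  proof (intro K.filled_sum K.filled_of_nat_mult)
    fix p' q' assume p': "p' \<in> proj B x" and q': "q' \<in> proj B y"
    have mem: "p \<in> B" "q \<in> B" "p' \<in> B" "q' \<in> B" using p q p' q' proj_mem by auto
    then have cc: "p \<in> carrier G" "q \<in> carrier G" "p' \<in> carrier G" "q' \<in> carrier G"
      using coset_mem[OF B] by auto
    have "inv p' \<otimes> q' = (inv p' \<otimes> p) \<otimes> ((inv p \<otimes> q) \<otimes> (inv q \<otimes> q'))"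
      using cc by (simp add: m_assoc) (simp add: m_assoc[symmetric])
    moreover have "inv p' \<otimes> p \<in> small (12 * D)" "inv q \<otimes> q' \<in> small (12 * D)"
      using close_self[OF B c(1)] close_self[OF B c(2)] p q p' q' small_mono[of D "12 * D"]
      unfolding close_def by auto
    ultimately show "antisym (inv p' \<otimes> q') - antisym (inv p \<otimes> q) \<in> filled_H 8"
      using antisym_near coset_diff[OF B mem(1,2)] by simp
  qed
  also have "(\<Sum>p'\<in>proj B x. \<Sum>q'\<in>proj B y. ?W * 8) = 8 * (denominator * denominator)"
    by (simp only: total[symmetric] sum_distrib_right[symmetric] mult.commute[of 8])
  finally show ?thesis .
qed

text \<open>
  Only cosets with far apart projections count.  The threshold \<open>12 * D\<close> is twice the one that
  separates the cases below, so that one distant pair among three points forces a second one.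
\<close>

definition far_chain :: "'a set \<Rightarrow> 'a \<Rightarrow> 'a \<Rightarrow> 'a \<Rightarrow> int" where
  "far_chain B x y = (if close (12 * D) B x y then 0 else coset_chain B x y)"

lemma far_chain_swap:
  assumes B: "B \<in> cosets"
  shows "far_chain B y x = - far_chain B x y"
proof -
  have "close (12 * D) B y x \<longleftrightarrow> close (12 * D) B x y"
    using close_sym[OF B] by blast
  then show ?thesis
    unfolding far_chain_def coset_chain_swap[OF B, of y x]
    by (cases "close (12 * D) B x y") (simp_all only: if_True if_False minus_zero simp_thms)
qed

lemma far_chain_approx:
  assumes B: "B \<in> cosets" and c: "x \<in> carrier G" "y \<in> carrier G"
    and p: "p \<in> proj B x" and q: "q \<in> proj B y"
  shows "far_chain B x y - of_nat (denominator * denominator) * antisym (inv p \<otimes> q) \<in> filled_H (8 * (denominator * denominator))"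
proof (cases "close (12 * D) B x y")
  case True
  then have "antisym (inv p \<otimes> q) \<in> filled_H 2"
    using p q antisym_small unfolding close_def by blast
  then have "of_nat (denominator * denominator) * antisym (inv p \<otimes> q) \<in> filled_H (denominator * denominator * 2)"
    by (rule K.filled_of_nat_mult)
  then have "0 - of_nat (denominator * denominator) * antisym (inv p \<otimes> q) \<in> filled_H (0 + denominator * denominator * 2)"
    by (rule K.filled_diff[OF K.zero_filled])
  then show ?thesis
    using True K.filled_mono[of "0 + denominator * denominator * 2" "8 * (denominator * denominator)"] unfolding far_chain_def by simp
next
  case False
  then show ?thesis using coset_chain_approx[OF assms] unfolding far_chain_def by simp
qed

definition triangle_sum :: "'a set \<Rightarrow> 'a \<Rightarrow> 'a \<Rightarrow> 'a \<Rightarrow> 'a \<Rightarrow> int" where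
  "triangle_sum B x y z = far_chain B x y + far_chain B y z - far_chain B x z"

lemma triangle_sum_filled:
  assumes B: "B \<in> cosets" and c: "x \<in> carrier G" "y \<in> carrier G" "z \<in> carrier G"
  shows "triangle_sum B x y z \<in> filled_H (26 * (denominator * denominator))"
proof -
  let ?w = "denominator * denominator"
  obtain p where p: "p \<in> proj B x" using proj_nonempty[OF B] by blast
  obtain q where q: "q \<in> proj B y" using proj_nonempty[OF B] by blast
  obtain r where r: "r \<in> proj B z" using proj_nonempty[OF B] by blast
  have mem: "p \<in> B" "q \<in> B" "r \<in> B" using p q r proj_mem by auto
  then have cc: "p \<in> carrier G" "q \<in> carrier G" "r \<in> carrier G" using coset_mem[OF B] by auto
  have "(inv p \<otimes> q) \<otimes> (inv q \<otimes> r) = inv p \<otimes> r"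
    using cc by (simp add: m_assoc) (simp add: m_assoc[symmetric])
  then have tri: "antisym (inv p \<otimes> q) + antisym (inv q \<otimes> r) - antisym (inv p \<otimes> r) \<in> filled_H 2"
    using antisym_mult coset_diff[OF B mem(1,2)] coset_diff[OF B mem(2,3)] by metis
  have "triangle_sum B x y z =
      (far_chain B x y - of_nat ?w * antisym (inv p \<otimes> q)) + (far_chain B y z - of_nat ?w * antisym (inv q \<otimes> r))
      - (far_chain B x z - of_nat ?w * antisym (inv p \<otimes> r))
      + of_nat ?w * (antisym (inv p \<otimes> q) + antisym (inv q \<otimes> r) - antisym (inv p \<otimes> r))"
    unfolding triangle_sum_def by (simp add: algebra_simps)
  also have "\<dots> \<in> filled_H (8 * ?w + 8 * ?w + 8 * ?w + ?w * 2)"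
    by (intro K.filled_add K.filled_diff K.filled_of_nat_mult far_chain_approx tri B c p q r)
  finally show ?thesis by (simp add: mult.commute[of _ 2])
qed

section \<open>The cosets that contribute to a triangle\<close>

text \<open>
  Centres and forks are the cosets where the contributions of a triangle need not cancel: at a
  centre all three sides may contribute, at a fork two sides contribute differently.
\<close>

definition centres :: "'a \<Rightarrow> 'a \<Rightarrow> 'a \<Rightarrow> 'a set set" where
  "centres x y z = {B \<in> cosets. \<not> close (6 * D) B x y \<and> \<not> close (6 * D) B y z \<and> \<not> close (6 * D) B x z}"

definition forks :: "'a \<Rightarrow> 'a \<Rightarrow> 'a \<Rightarrow> 'a set set" where
  "forks x y z = {B \<in> cosets. \<not> close (6 * D) B x y \<and> \<not> close (6 * D) B x z \<and> close (6 * D) B y z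
                    \<and> proj B y \<noteq> proj B z}"

lemma close_common:
  assumes "B \<in> cosets" "close (3 * D) B c x" "close (3 * D) B c y"
  shows "close (6 * D) B x y"
  using close_trans[OF assms(1) close_sym[OF assms(1,2)] assms(3)] by simp

text \<open>
  For each of three points, one of two centres \<open>B\<close> and \<open>C\<close> sees it in the direction of the other
  one.  Two of the points are seen by the same centre, and have nearby projections there.
\<close>

lemma centres_unique:
  assumes c: "x \<in> carrier G" "y \<in> carrier G" "z \<in> carrier G"
    and B: "B \<in> centres x y z" and C: "C \<in> centres x y z"
  shows "B = C"
proof (rule ccontr)
  assume "B \<noteq> C"
  have BC: "B \<in> cosets" "C \<in> cosets" using B C unfolding centres_def by auto
  obtain b where b: "b \<in> B" using coset_nonempty[OF BC(1)] by blast
  obtain c where c': "c \<in> C" using coset_nonempty[OF BC(2)] by blast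
  have *: "close (3 * D) B c t \<or> close (3 * D) C b t" if "t \<in> carrier G" for t
    using behrstock[OF BC \<open>B \<noteq> C\<close> b c' that] .
  show False
    using *[OF c(1)] *[OF c(2)] *[OF c(3)] close_common[OF BC(1), of c] close_common[OF BC(2), of b] B C
    unfolding centres_def by blast
qed

text \<open>
  By \<open>behrstock\<close>, one of two forks, say \<open>C\<close>, has the other one, \<open>B\<close>, on the side of \<open>x\<close>.  Then
  \<open>C\<close> separates \<open>B\<close> both from \<open>y\<close> and from \<open>z\<close>, so that \<open>proj_eq_gate\<close> gives the same
  projection of \<open>y\<close> and \<open>z\<close> to \<open>B\<close>.
\<close>

lemma forks_unique:
  assumes c: "x \<in> carrier G" "y \<in> carrier G" "z \<in> carrier G"
    and B: "B \<in> forks x y z" and C: "C \<in> forks x y z"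
  shows "B = C"
proof (rule ccontr)
  assume ne: "B \<noteq> C"
  have BC: "B \<in> cosets" "C \<in> cosets" using B C unfolding forks_def by auto
  obtain b where b: "b \<in> B" using coset_nonempty[OF BC(1)] by blast
  obtain c where c': "c \<in> C" using coset_nonempty[OF BC(2)] by blast
  have hidden: "proj B' y = proj B' z"
    if B': "B' \<in> cosets" "C' \<in> forks x y z" "B' \<noteq> C'" "b' \<in> B'" "close (3 * D) C' b' x" for B' C' b'
  proof -
    have C': "C' \<in> cosets" "\<not> close (6 * D) C' x y" "\<not> close (6 * D) C' x z"
      using B'(2) unfolding forks_def by auto
    have far: "\<not> close (2 * D) C' b' t" if "\<not> close (6 * D) C' x t" for t
    proof
      assume "close (2 * D) C' b' t"
      then have "close (3 * D + 2 * D) C' x t"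
        using close_trans[OF C'(1) close_sym[OF C'(1) B'(5)]] by blast
      \<comment> \<open>The threshold \<open>6 * D\<close> exceeds the sum of the errors of \<open>behrstock\<close> and \<open>proj_eq_gate\<close>.\<close>
      then show False using that close_mono[of "3 * D + 2 * D" "6 * D"] by simp
    qed
    show ?thesis
      using proj_eq_gate[OF B'(1) C'(1) B'(3,4)] far C'(2,3) c by simp
  qed
  show False
    using behrstock[OF BC ne b c' c(1)]
  proof
    assume "close (3 * D) B c x"
    then show False using hidden[OF BC(2) B _ c'] ne C unfolding forks_def by auto
  next
    assume "close (3 * D) C b x"
    then show False using hidden[OF BC(1) C ne b] B unfolding forks_def by auto
  qed
qed

lemma far_chain_cong: "proj B y = proj B z \<Longrightarrow> far_chain B x y = far_chain B x z"
  unfolding far_chain_def coset_chain_def weight_def close_def by simp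

text \<open>
  If two of the three pairs have nearby projections, none of the pairs counts.  If exactly one
  pair does, say \<open>y\<close> and \<open>z\<close>, their projections coincide outside the forks, and the
  contributions of the other two pairs cancel exactly.
\<close>

lemma triangle_sum_support:
  assumes B: "B \<in> cosets" and c: "x \<in> carrier G" "y \<in> carrier G" "z \<in> carrier G"
    and nz: "triangle_sum B x y z \<noteq> 0"
  shows "B \<in> centres x y z \<union> forks x y z \<union> forks y x z \<union> forks z x y"
proof (rule ccontr)
  assume outside: "\<not> ?thesis"
  let ?c = "close (6 * D) B"
  have sym: "?c u v \<longleftrightarrow> ?c v u" for u v using close_sym[OF B] by blast
  have zero: "far_chain B u v = 0" if "?c u v" for u v
    using close_mono[of "6 * D" "12 * D" B u v] that unfolding far_chain_def by simp
  have zero2: "far_chain B u v = 0" if "?c u t" "?c t v" for u v t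
    using close_trans[OF B that] unfolding far_chain_def by simp
  have swap: "far_chain B u v = - far_chain B v u" for u v using far_chain_swap[OF B] .
  consider (two) "(?c x y \<and> ?c y z) \<or> (?c x y \<and> ?c x z) \<or> (?c x z \<and> ?c y z)"
    | (yz) "?c y z" "\<not> ?c x y" "\<not> ?c x z" | (xz) "?c x z" "\<not> ?c x y" "\<not> ?c y z"
    | (xy) "?c x y" "\<not> ?c x z" "\<not> ?c y z" | (none) "\<not> ?c x y" "\<not> ?c y z" "\<not> ?c x z"
    by blast
  then have "triangle_sum B x y z = 0"
  proof cases
    case two
    then have "far_chain B x y = 0" "far_chain B y z = 0" "far_chain B x z = 0"
      using zero zero2[of x y z] zero2[of y x z] zero2[of x z y] sym by blast+
    then show ?thesis unfolding triangle_sum_def by (simp only: diff_self add_0)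
  next
    case yz
    then have "proj B y = proj B z" using outside B unfolding forks_def by auto
    then show ?thesis
      unfolding triangle_sum_def zero[OF yz(1)] by (simp only: far_chain_cong[of B y z x] add_0_right diff_self)
  next
    case xz
    then have "proj B x = proj B z" using outside B sym unfolding forks_def by auto
    then have "far_chain B y z = - far_chain B x y" using far_chain_cong[of B x z y] swap[of y x] by simp
    then show ?thesis
      unfolding triangle_sum_def zero[OF xz(1)] by (simp only: add.right_inverse diff_0_right)
  next
    case xy
    then have "proj B x = proj B y" using outside B sym unfolding forks_def by auto
    then have "far_chain B y z = far_chain B x z" using far_chain_cong[of B x y z] swap[of _ z] by metis
    then show ?thesis
      unfolding triangle_sum_def zero[OF xy(1)] by (simp only: add_0 diff_self)
  next
    case none
    then show ?thesis using outside B unfolding centres_def by auto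
  qed
  then show False using nz by blast
qed

lemma card_subsingleton: "(\<And>a b. a \<in> A \<Longrightarrow> b \<in> A \<Longrightarrow> a = b) \<Longrightarrow> finite A \<and> card A \<le> 1"
  by (metis (no_types, lifting) card.empty card_1_singleton_iff finite.emptyI finite_insert is_singletonI'
      is_singleton_altdef is_singleton_the_elem le_numeral_extra(4) zero_le_one)

lemma triangle_sum_support_card:
  assumes c: "x \<in> carrier G" "y \<in> carrier G" "z \<in> carrier G"
  shows "finite {B \<in> cosets. triangle_sum B x y z \<noteq> 0}" (is "finite ?S")
    and "card {B \<in> cosets. triangle_sum B x y z \<noteq> 0} \<le> 4"
proof -
  let ?T = "centres x y z \<union> forks x y z \<union> forks y x z \<union> forks z x y"
  have sub: "?S \<subseteq> ?T" using triangle_sum_support[OF _ c] by blast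
  have "finite (centres x y z) \<and> card (centres x y z) \<le> 1"
    by (rule card_subsingleton) (rule centres_unique[OF c])
  moreover have "finite (forks x y z) \<and> card (forks x y z) \<le> 1"
    by (rule card_subsingleton) (rule forks_unique[OF c])
  moreover have "finite (forks y x z) \<and> card (forks y x z) \<le> 1"
    by (rule card_subsingleton) (rule forks_unique[OF c(2,1,3)])
  moreover have "finite (forks z x y) \<and> card (forks z x y) \<le> 1"
    by (rule card_subsingleton) (rule forks_unique[OF c(3,1,2)])
  ultimately have s: "finite (centres x y z) \<and> card (centres x y z) \<le> 1"
    "finite (forks x y z) \<and> card (forks x y z) \<le> 1"
    "finite (forks y x z) \<and> card (forks y x z) \<le> 1"
    "finite (forks z x y) \<and> card (forks z x y) \<le> 1" by blast+
  then show "finite ?S" using sub finite_subset by blast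
  have "card ?T \<le> 4"
    using s card_Un_le[of "centres x y z \<union> forks x y z \<union> forks y x z" "forks z x y"]
      card_Un_le[of "centres x y z \<union> forks x y z" "forks y x z"] card_Un_le[of "centres x y z" "forks x y z"]
    by linarith
  moreover have "finite ?T" using s by simp
  ultimately show "card ?S \<le> 4" using card_mono[OF _ sub] by simp
qed

section \<open>The transfer of chains to the subgroup\<close>

definition far_cosets :: "'a \<Rightarrow> 'a \<Rightarrow> 'a set set" where
  "far_cosets x y = {B \<in> cosets. \<not> close (12 * D) B x y}"

text \<open>
  Each of these cosets contains a vertex of a fixed geodesic from \<open>x\<close> to \<open>y\<close>.
\<close>

lemma finite_far_cosets:
  assumes "x \<in> carrier G" "y \<in> carrier G"
  shows "finite (far_cosets x y)"
proof -
  obtain \<gamma> where \<gamma>: "geodesic \<gamma> x y" using geodesic_exists assms by blast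
  have "B \<in> (\<lambda>i. \<gamma> i <# H) ` {..<word_dist x y}" if "B \<in> far_cosets x y" for B
  proof -
    have B: "B \<in> cosets" "\<not> close D B x y"
      using that close_mono[of D "12 * D"] unfolding far_cosets_def by auto
    obtain i where i: "i < word_dist x y" "\<gamma> i \<in> B"
      using geodesic_through_coset[OF B(1) assms \<gamma> B(2)] by blast
    then have "\<gamma> i \<in> carrier G" using coset_mem[OF B(1)] by blast
    then have "\<gamma> i <# H \<in> cosets" "\<gamma> i \<in> \<gamma> i <# H"
      unfolding cosets_def using self_mem_coset by auto
    then have "B = \<gamma> i <# H" using coset_eqI[OF B(1) _ i(2)] by blast
    then show ?thesis using i(1) by blast
  qed
  then show ?thesis using finite_subset[of "far_cosets x y" "(\<lambda>i. \<gamma> i <# H) ` {..<word_dist x y}"] by blast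
qed

definition transfer :: "'a \<Rightarrow> 'a \<Rightarrow> 'a \<Rightarrow> int" where
  "transfer x y = (\<Sum>B\<in>far_cosets x y. far_chain B x y)"

lemma transfer_superset:
  assumes "finite U" "far_cosets x y \<subseteq> U" "U \<subseteq> cosets"
  shows "transfer x y = (\<Sum>B\<in>U. far_chain B x y)"
  unfolding transfer_def using assms
  by (intro sum.mono_neutral_left) (auto simp: far_cosets_def far_chain_def)

lemma transfer_quasi_additive:
  assumes c: "x \<in> carrier G" "y \<in> carrier G" "z \<in> carrier G"
  shows "transfer x y + transfer y z - transfer x z \<in> filled_H (104 * (denominator * denominator))"
proof -
  let ?U = "far_cosets x y \<union> far_cosets y z \<union> far_cosets x z"
  let ?S = "{B \<in> cosets. triangle_sum B x y z \<noteq> 0}"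
  have U: "finite ?U" "?U \<subseteq> cosets" using finite_far_cosets c unfolding far_cosets_def by auto
  have "transfer x y + transfer y z - transfer x z = (\<Sum>B\<in>?U. triangle_sum B x y z)"
    using transfer_superset[OF U(1) _ U(2), of x y] transfer_superset[OF U(1) _ U(2), of y z]
      transfer_superset[OF U(1) _ U(2), of x z]
    unfolding triangle_sum_def by (simp only: sum.distrib sum_subtractf Un_upper1 Un_upper2 le_supI1)
  also have "\<dots> = (\<Sum>B\<in>?U \<inter> ?S. triangle_sum B x y z)"
    using U by (intro sum.mono_neutral_right) auto
  also have "\<dots> \<in> filled_H (\<Sum>B\<in>?U \<inter> ?S. 26 * (denominator * denominator))"
    using triangle_sum_filled c by (intro K.filled_sum) blast
  finally have "transfer x y + transfer y z - transfer x z \<in> filled_H (card (?U \<inter> ?S) * (26 * (denominator * denominator)))"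
    by (simp only: sum_constant of_nat_id)
  moreover have "card (?U \<inter> ?S) \<le> 4"
    using triangle_sum_support_card[OF c] card_mono[of ?S "?U \<inter> ?S"] by auto
  then have "card (?U \<inter> ?S) * (26 * (denominator * denominator)) \<le> 4 * (26 * (denominator * denominator))"
    by (rule mult_le_mono1)
  then have "card (?U \<inter> ?S) * (26 * (denominator * denominator)) \<le> 104 * (denominator * denominator)"
    by linarith
  ultimately show ?thesis by (rule K.filled_mono[rotated])
qed

lemma diff_translate:
  assumes "p \<in> carrier G" "q \<in> carrier G" "g \<in> carrier G"
  shows "inv (g \<otimes> p) \<otimes> (g \<otimes> q) = inv p \<otimes> q"
  using assms by (simp add: inv_mult_group m_assoc) (simp add: m_assoc[symmetric])

lemma far_chain_translate:
  assumes B: "B \<in> cosets" and c: "x \<in> carrier G" "y \<in> carrier G" "g \<in> carrier G"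
  shows "close n (g <# B) (g \<otimes> x) (g \<otimes> y) \<longleftrightarrow> close n B x y"
    and "far_chain (g <# B) (g \<otimes> x) (g \<otimes> y) = far_chain B x y"
proof -
  have pc: "p \<in> carrier G" if "p \<in> proj B t" for p t using that proj_mem coset_mem[OF B] by blast
  have inj: "inj_on ((\<otimes>) g) (proj B t)" for t using pc c(3) by (intro inj_onI) auto
  note pt = proj_translate[OF B c(1,3)] proj_translate[OF B c(2,3)]
  have diff: "inv (g \<otimes> p) \<otimes> (g \<otimes> q) = inv p \<otimes> q" if "p \<in> proj B x" "q \<in> proj B y" for p q
    using that pc diff_translate[OF _ _ c(3)] by blast
  show close: "close n (g <# B) (g \<otimes> x) (g \<otimes> y) \<longleftrightarrow> close n B x y" for n
    unfolding close_def pt using diff by simp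
  have w: "weight (g <# B) (g \<otimes> x) = weight B x" "weight (g <# B) (g \<otimes> y) = weight B y"
    unfolding weight_def pt using inj by (simp_all add: card_image)
  have "coset_chain (g <# B) (g \<otimes> x) (g \<otimes> y) = coset_chain B x y"
    unfolding coset_chain_def w unfolding pt sum.reindex[OF inj] comp_def
    by (intro sum.cong refl) (simp only: diff)
  then show "far_chain (g <# B) (g \<otimes> x) (g \<otimes> y) = far_chain B x y"
    unfolding far_chain_def close by simp
qed

lemma transfer_translate:
  assumes c: "x \<in> carrier G" "y \<in> carrier G" "g \<in> carrier G"
  shows "transfer (g \<otimes> x) (g \<otimes> y) = transfer x y"
proof -
  have undo: "g <# (inv g <# B) = B" "inv g <# (g <# B) = B" if "B \<in> cosets" for B
    using that c(3) coset_closed by (simp_all add: lcos_m_assoc lcos_mult_one)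
  have "bij_betw (\<lambda>B. g <# B) (far_cosets x y) (far_cosets (g \<otimes> x) (g \<otimes> y))"
  proof (rule bij_betw_byWitness[where f' = "\<lambda>B. inv g <# B"])
    show "(\<lambda>B. g <# B) ` far_cosets x y \<subseteq> far_cosets (g \<otimes> x) (g \<otimes> y)"
      using far_chain_translate(1) coset_translate c unfolding far_cosets_def by auto
    show "(\<lambda>B. inv g <# B) ` far_cosets (g \<otimes> x) (g \<otimes> y) \<subseteq> far_cosets x y"
    proof
      fix C assume "C \<in> (\<lambda>B. inv g <# B) ` far_cosets (g \<otimes> x) (g \<otimes> y)"
      then obtain B where B: "B \<in> cosets" "\<not> close (12 * D) B (g \<otimes> x) (g \<otimes> y)" "C = inv g <# B"
        unfolding far_cosets_def by blast
      have "C \<in> cosets" using coset_translate[OF B(1), of "inv g"] c(3) B(3) by simp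
      then show "C \<in> far_cosets x y"
        using far_chain_translate(1)[OF _ c, of C "12 * D"] B undo(1)[OF B(1)] unfolding far_cosets_def by simp
    qed
  qed (use undo in \<open>auto simp: far_cosets_def\<close>)
  from sum.reindex_bij_betw[OF this, of "\<lambda>B. far_chain B (g \<otimes> x) (g \<otimes> y)"]
  have "transfer (g \<otimes> x) (g \<otimes> y) = (\<Sum>B\<in>far_cosets x y. far_chain (g <# B) (g \<otimes> x) (g \<otimes> y))"
    unfolding transfer_def by simp
  also have "\<dots> = transfer x y"
    unfolding transfer_def using far_chain_translate(2) c by (intro sum.cong refl) (auto simp: far_cosets_def)
  finally show ?thesis .
qed

definition chain :: "'a \<Rightarrow> 'a \<Rightarrow> int" where
  "chain g = transfer \<one> g"

definition defect :: nat where "defect = 104 * (denominator * denominator)"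

lemma chain_mult:
  assumes "g \<in> carrier G" "k \<in> carrier G"
  shows "chain g + chain k - chain (g \<otimes> k) \<in> filled_H defect"
  using transfer_quasi_additive[of \<one> g "g \<otimes> k"] transfer_translate[of \<one> k g] assms
  unfolding chain_def defect_def by simp

lemma chain_one: "chain \<one> \<in> filled_H defect"
  using chain_mult[of \<one> \<one>] by simp

lemma chain_inv:
  assumes "g \<in> carrier G"
  shows "chain g + chain (inv g) \<in> filled_H (2 * defect)"
proof -
  have "(chain g + chain (inv g) - chain (g \<otimes> inv g)) + chain \<one> \<in> filled_H (defect + defect)"
    using assms by (intro K.filled_add chain_mult chain_one) auto
  moreover have "(chain g + chain (inv g) - chain (g \<otimes> inv g)) + chain \<one> = chain g + chain (inv g)"
    using assms by simp
  ultimately show ?thesis by (simp only: mult_2)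
qed

text \<open>
  In \<open>[x, y]\<close> the chains of \<open>x\<close> and \<open>y\<close> cancel with those of their inverses, up to three errors
  from products and two from inverses.
\<close>

lemma chain_commutator:
  assumes "c \<in> commutators"
  shows "chain c \<in> filled_H (7 * defect)"
proof -
  obtain x y where xy: "x \<in> carrier G" "y \<in> carrier G" "c = x \<otimes> y \<otimes> inv x \<otimes> inv y"
    using assms by (rule commutatorE)
  let ?a = "x \<otimes> y" and ?b = "x \<otimes> y \<otimes> inv x"
  have "chain c = (chain x + chain (inv x)) + (chain y + chain (inv y))
      - ((chain x + chain y - chain ?a) + (chain ?a + chain (inv x) - chain ?b)
         + (chain ?b + chain (inv y) - chain (?b \<otimes> inv y)))"
    unfolding xy(3) by (simp add: algebra_simps)
  also have "\<dots> \<in> filled_H (2 * defect + 2 * defect + (defect + defect + defect))"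
    using xy by (intro K.filled_diff K.filled_add chain_inv chain_mult) auto
  finally show ?thesis by (simp add: algebra_simps)
qed

lemma chain_commutator_products:
  assumes "g \<in> commutator_products n"
  shows "chain g \<in> filled_H (8 * defect * n + defect)"
proof -
  have *: "chain (list_prod cs) \<in> filled_H (8 * defect * length cs + defect)"
    if "set cs \<subseteq> commutators" for cs
    using that
  proof (induction cs)
    case Nil
    then show ?case using chain_one by simp
  next
    case (Cons c cs)
    have c: "c \<in> commutators" "set cs \<subseteq> commutators" using Cons.prems by auto
    then have cc: "c \<in> carrier G" "list_prod cs \<in> carrier G"
      using commutators_closed list_prod_closed[of cs] by auto
    have "chain (list_prod (c # cs)) =
        (chain c + chain (list_prod cs)) - (chain c + chain (list_prod cs) - chain (c \<otimes> list_prod cs))"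
      by simp
    also have "\<dots> \<in> filled_H ((7 * defect + (8 * defect * length cs + defect)) + defect)"
      using c cc Cons.IH by (intro K.filled_diff K.filled_add chain_mult chain_commutator) auto
    also have "(7 * defect + (8 * defect * length cs + defect)) + defect = 8 * defect * length (c # cs) + defect"
      by (simp add: algebra_simps)
    finally show ?case .
  qed
  obtain cs where cs: "g = list_prod cs" "length cs \<le> n" "set cs \<subseteq> commutators"
    using assms by (rule commutator_productsE)
  have "8 * defect * length cs + defect \<le> 8 * defect * n + defect"
    using cs(2) by simp
  then show ?thesis using *[OF cs(3)] K.filled_mono cs(1) by blast
qed

text \<open>
  The points \<open>1\<close> and \<open>h\<close> lie in the coset \<open>H\<close>, which is therefore the only one that can
  contribute, and they are their own projections to it.
\<close>

lemma chain_H: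
  assumes h: "h \<in> H"
  shows "of_nat (2 * (denominator * denominator)) * single h - chain h \<in> filled_H (10 * (denominator * denominator))"
proof -
  let ?w = "denominator * denominator"
  have hc: "h \<in> carrier G" using h by simp
  have "far_cosets \<one> h \<subseteq> {H}"
  proof
    fix B assume B: "B \<in> far_cosets \<one> h"
    show "B \<in> {H}"
    proof (rule ccontr)
      assume "B \<notin> {H}"
      then have "close D B \<one> h"
        using B h close_on_other_coset[OF _ H_coset] unfolding far_cosets_def by auto
      then show False using B close_mono[of D "12 * D"] unfolding far_cosets_def by auto
    qed
  qed
  then have "chain h = (\<Sum>B\<in>{H}. far_chain B \<one> h)"
    unfolding chain_def using H_coset by (intro transfer_superset) auto
  then have chain: "chain h = far_chain H \<one> h" by simp
  have "\<one> \<in> proj H \<one>" "h \<in> proj H h" unfolding proj_def using h by auto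
  then have 1: "chain h - of_nat ?w * antisym h \<in> filled_H (8 * ?w)"
    using far_chain_approx[OF H_coset _ hc, of \<one> \<one> h] hc chain by simp
  have 2: "of_nat ?w * (antisym h - of_nat 2 * single h) \<in> filled_H (?w * 2)"
    by (intro K.filled_of_nat_mult antisym_single h)
  have "of_nat (2 * ?w) * single h - chain h =
      - ((chain h - of_nat ?w * antisym h) + of_nat ?w * (antisym h - of_nat 2 * single h))"
    by (simp add: algebra_simps)
  also have "\<dots> \<in> filled_H (8 * ?w + ?w * 2)"
    by (intro K.filled_uminus K.filled_add 1 2)
  finally show ?thesis by (simp add: algebra_simps)
qed

text \<open>
  The chain of \<open>h\<close> has a filling of length linear in \<open>cl G h\<close> and differs from a fixed multiple of
  \<open>[h]\<close> by a bounded filling, to which \<open>filled_power\<close> applies within \<open>H\<close>.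
\<close>

lemma cl_power_bound:
  "\<exists>(k::nat) A C. k \<ge> 1 \<and> (\<forall>h\<in>derived G H. cl (G\<lparr>carrier := H\<rparr>) (h [^] k) \<le> A * cl G h + C)"
proof -
  let ?w = "denominator * denominator" and ?S = "small (12 * D)"
  have "?S \<subseteq> carrier (G\<lparr>carrier := H\<rparr>)" using small_H by auto
  from K.filled_power[OF finite_small this] obtain C0 where
    "\<forall>h\<in>derived (G\<lparr>carrier := H\<rparr>) (carrier (G\<lparr>carrier := H\<rparr>)). \<forall>k m. of_nat k * single h \<in> filled_H m \<longrightarrow>
       h [^]\<^bsub>G\<lparr>carrier := H\<rparr>\<^esub> k \<in> K.commutator_products (k + C0 * m)" ..
  note C0 = this[rule_format]
  have "cl (G\<lparr>carrier := H\<rparr>) (h [^] (2 * ?w))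
      \<le> C0 * (8 * defect) * cl G h + (2 * ?w + C0 * (defect + 10 * ?w))" if h: "h \<in> derived G H" for h
  proof -
    have hK: "h \<in> derived (G\<lparr>carrier := H\<rparr>) (carrier (G\<lparr>carrier := H\<rparr>))"
      using h by (simp add: derived_consistent[OF subset_refl subgroup_H])
    have hH: "h \<in> H" using h derived_incl[OF subset_refl subgroup_H] by blast
    have "h \<in> derived G (carrier G)" using h mono_derived[OF H.subset] by blast
    then have "chain h \<in> filled_H (8 * defect * cl G h + defect)"
      by (intro chain_commutator_products commutator_products_cl)
    then have "(of_nat (2 * ?w) * single h - chain h) + chain h
        \<in> filled_H (10 * ?w + (8 * defect * cl G h + defect))"
      by (intro K.filled_add chain_H hH)
    then have "of_nat (2 * ?w) * single h \<in> filled_H (10 * ?w + (8 * defect * cl G h + defect))"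
      by (simp only: diff_add_cancel)
    then have "h [^]\<^bsub>G\<lparr>carrier := H\<rparr>\<^esub> (2 * ?w) \<in>
        K.commutator_products (2 * ?w + C0 * (10 * ?w + (8 * defect * cl G h + defect)))"
      by (rule C0[OF hK])
    then have "cl (G\<lparr>carrier := H\<rparr>) (h [^]\<^bsub>G\<lparr>carrier := H\<rparr>\<^esub> (2 * ?w))
        \<le> 2 * ?w + C0 * (10 * ?w + (8 * defect * cl G h + defect))"
      by (rule K.cl_le)
    then show ?thesis
      by (simp add: nat_pow_consistent[symmetric] algebra_simps)
  qed
  moreover have "2 * ?w \<ge> 1" unfolding denominator_def by simp
  ultimately show ?thesis by blast
qed

end

section \<open>The relative Cayley graph as a metric graph\<close>

text \<open>
  The length of paths is all that matters for distances, so the lists of arcs in the definition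
  of graph distances are traded for powers of the adjacency relation.
\<close>

lemma walk_iff_relpow:
  "(\<exists>p. length p = n \<and> set p \<subseteq> arcs \<Delta> \<and> pre_digraph.cas \<Delta> u p v) \<longleftrightarrow>
     (u, v) \<in> ((\<lambda>e. (tail \<Delta> e, head \<Delta> e)) ` arcs \<Delta>) ^^ n"
proof (induction n arbitrary: u)
  case 0
  show ?case by (auto simp: pre_digraph.cas.simps)
next
  case (Suc n)
  let ?R = "(\<lambda>e. (tail \<Delta> e, head \<Delta> e)) ` arcs \<Delta>"
  have "(\<exists>p. length p = Suc n \<and> set p \<subseteq> arcs \<Delta> \<and> pre_digraph.cas \<Delta> u p v) \<longleftrightarrow>
      (\<exists>e\<in>arcs \<Delta>. tail \<Delta> e = u \<and> (\<exists>p. length p = n \<and> set p \<subseteq> arcs \<Delta> \<and> pre_digraph.cas \<Delta> (head \<Delta> e) p v))"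
    by (force simp: length_Suc_conv pre_digraph.cas.simps)
  also have "\<dots> \<longleftrightarrow> (\<exists>w. (u, w) \<in> ?R \<and> (w, v) \<in> ?R ^^ n)"
    unfolding Suc.IH by auto
  also have "\<dots> \<longleftrightarrow> (u, v) \<in> ?R ^^ Suc n"
    unfolding relpow.simps relpow_commute[symmetric] by auto
  finally show ?case .
qed

definition joined :: "('v, 'e) pre_digraph \<Rightarrow> ('v \<times> 'v) set" where
  "joined \<Gamma> = (\<lambda>e. (tail (bidirect \<Gamma>) e, head (bidirect \<Gamma>) e)) ` arcs (bidirect \<Gamma>)"

lemma joined_iff:
  "(u, v) \<in> joined \<Gamma> \<longleftrightarrow>
     (\<exists>e\<in>arcs \<Gamma>. (u = tail \<Gamma> e \<and> v = head \<Gamma> e) \<or> (u = head \<Gamma> e \<and> v = tail \<Gamma> e))"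
proof -
  have "(u, v) \<in> joined \<Gamma> \<longleftrightarrow>
      (\<exists>e\<in>arcs \<Gamma>. \<exists>b. u = (if b then tail \<Gamma> e else head \<Gamma> e) \<and> v = (if b then head \<Gamma> e else tail \<Gamma> e))"
    unfolding joined_def bidirect_def image_iff by simp
  also have "\<dots> \<longleftrightarrow>
      (\<exists>e\<in>arcs \<Gamma>. (u = tail \<Gamma> e \<and> v = head \<Gamma> e) \<or> (u = head \<Gamma> e \<and> v = tail \<Gamma> e))"
    by (simp add: ex_bool_eq)
  finally show ?thesis .
qed

lemma graph_dist_le:
  assumes "(u, v) \<in> joined \<Gamma> ^^ n" and "u \<in> verts \<Gamma>"
  shows "graph_dist \<Gamma> u v \<le> ereal (real n)"
proof -
  obtain p where p: "length p = n" "set p \<subseteq> arcs (bidirect \<Gamma>)" "pre_digraph.cas (bidirect \<Gamma>) u p v"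
    using assms(1) unfolding joined_def walk_iff_relpow[symmetric] by blast
  then have "pre_digraph.awalk (bidirect \<Gamma>) u p v"
    using assms(2) by (simp add: pre_digraph.awalk_def bidirect_def)
  then show ?thesis
    unfolding graph_dist_def using p(1) by (intro INF_lower2[of p]) auto
qed

lemma graph_dist_ge:
  assumes "\<And>n. (u, v) \<in> joined \<Gamma> ^^ n \<Longrightarrow> m \<le> n"
  shows "ereal (real m) \<le> graph_dist \<Gamma> u v"
  unfolding graph_dist_def
proof (rule INF_greatest)
  fix p assume "p \<in> {p. pre_digraph.awalk (bidirect \<Gamma>) u p v}"
  then have "(u, v) \<in> joined \<Gamma> ^^ length p"
    unfolding joined_def walk_iff_relpow[symmetric] by (auto simp: pre_digraph.awalk_def)
  then show "ereal (real m) \<le> ereal (real (length p))" using assms by simp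
qed

context relative_cayley
begin

lemma arcs_relative_cayley_graph:
  "arcs (relative_cayley_graph G H X) = carrier G \<times> (Inl ` X \<union> Inr ` (H - {\<one>}))"
  by (simp add: relative_cayley_graph_def cayley_graph_def Plus_def)

lemma relative_cayley_graph_simps:
  "verts (relative_cayley_graph G H X) = carrier G"
  "tail (relative_cayley_graph G H X) (g, a) = g"
  "head (relative_cayley_graph G H X) (g, a) = g \<otimes> letter a"
  by (simp_all add: relative_cayley_graph_def cayley_graph_def)

lemma joined_relative_cayley_graph: "joined (relative_cayley_graph G H X) = step {}"
proof -
  have "(u, v) \<in> joined (relative_cayley_graph G H X) \<longleftrightarrow> (u, v) \<in> step {}" for u v
    unfolding joined_iff arcs_relative_cayley_graph step_def
    using X_closed H.subset
    by (auto simp: relative_cayley_graph_simps letter_def bex_Un; blast)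
  then show ?thesis by auto
qed

lemma graph_dist_eq_word_dist:
  assumes "x \<in> carrier G" "y \<in> carrier G"
  shows "graph_dist (relative_cayley_graph G H X) x y = ereal (real (word_dist x y))"
proof (rule antisym)
  show "graph_dist (relative_cayley_graph G H X) x y \<le> ereal (real (word_dist x y))"
    using word_dist_walk[OF assms] assms(1)
    by (intro graph_dist_le) (simp_all add: joined_relative_cayley_graph relative_cayley_graph_simps)
  show "ereal (real (word_dist x y)) \<le> graph_dist (relative_cayley_graph G H X) x y"
    by (intro graph_dist_ge word_dist_le) (simp add: joined_relative_cayley_graph)
qed

lemma word_dist_letter:
  assumes "y \<in> carrier G" "a \<in> Inl ` X \<union> Inr ` (H - {\<one>})"
  shows "y \<otimes> letter a \<in> carrier G" and "word_dist y (y \<otimes> letter a) \<le> 1"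
proof -
  show c: "y \<otimes> letter a \<in> carrier G"
    using assms X_closed by (auto simp: letter_def)
  have "(y, y \<otimes> letter a) \<in> step {}"
    using assms c unfolding step_def by (auto simp: letter_def)
  then show "word_dist y (y \<otimes> letter a) \<le> 1" using word_dist_le[of y "y \<otimes> letter a" 1] by simp
qed

text \<open>
  The vertex \<open>x\<close> is the starting point of any edge that leaves it.  Detours through the other
  end of such an edge cannot shorten a distance between vertices.
\<close>

lemma realization_dist_vertices:
  assumes c: "x \<in> carrier G" "y \<in> carrier G" and a: "a \<in> Inl ` X \<union> Inr ` (H - {\<one>})"
  shows "realization_dist (relative_cayley_graph G H X) ((x, a), 0) ((y, a), 0) = real (word_dist x y)"
proof -
  let ?x = "x \<otimes> letter a" and ?y = "y \<otimes> letter a"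
  have x': "?x \<in> carrier G" "word_dist x ?x \<le> 1" and y': "?y \<in> carrier G" "word_dist y ?y \<le> 1"
    using word_dist_letter a c by auto
  have "word_dist x y \<le> word_dist x ?y + word_dist ?y y" "word_dist x y \<le> word_dist x ?x + word_dist ?x y" "word_dist ?x y \<le> word_dist ?x ?y + word_dist ?y y"
    using word_dist_triangle c x'(1) y'(1) by blast+
  then have tri: "word_dist x y \<le> word_dist x ?y + 1" "word_dist x y \<le> 1 + word_dist ?x y" "word_dist x y \<le> 1 + word_dist ?x ?y + 1"
    using x' y' word_dist_sym[of ?y y] by linarith+
  have Min: "Min ({real (word_dist x y), real (word_dist x ?y) + 1, 1 + real (word_dist ?x y), 1 + real (word_dist ?x ?y) + 1} \<union> Z) = real (word_dist x y)"
    if Z: "Z \<subseteq> {0}" "Z \<noteq> {} \<Longrightarrow> x = y" for Z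
  proof (rule Min_eqI)
    show "finite ({real (word_dist x y), real (word_dist x ?y) + 1, 1 + real (word_dist ?x y), 1 + real (word_dist ?x ?y) + 1} \<union> Z)"
      using that finite_subset[of Z "{0}"] by simp
    fix t assume "t \<in> {real (word_dist x y), real (word_dist x ?y) + 1, 1 + real (word_dist ?x y), 1 + real (word_dist ?x ?y) + 1} \<union> Z"
    then consider "t = real (word_dist x y)" | "t = real (word_dist x ?y) + 1" | "t = 1 + real (word_dist ?x y)"
      | "t = 1 + real (word_dist ?x ?y) + 1" | "t = 0" "x = y"
      using Z by blast
    then show "real (word_dist x y) \<le> t"
      by cases (use tri in auto)
  qed auto
  show ?thesis
    unfolding realization_dist_def Let_def prod.case relative_cayley_graph_simps
      graph_dist_eq_word_dist[OF c] graph_dist_eq_word_dist[OF c(1) y'(1)] graph_dist_eq_word_dist[OF x'(1) c(2)]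
      graph_dist_eq_word_dist[OF x'(1) y'(1)] real_of_ereal.simps diff_0_right add_0_left add_0_right
    by (rule Min) (auto split: if_splits)
qed

text \<open>
  A graph without edges has no points in its realization, but then the group is trivial.
\<close>

lemma gromov_four_point:
  assumes "hyperbolic_graph (relative_cayley_graph G H X)"
  shows "\<exists>\<delta>::nat. \<forall>x\<in>carrier G. \<forall>y\<in>carrier G. \<forall>z\<in>carrier G. \<forall>w\<in>carrier G.
           word_dist x z + word_dist y w \<le> max (word_dist x y + word_dist z w) (word_dist y z + word_dist x w) + 2 * \<delta>"
proof (cases "Inl ` X \<union> Inr ` (H - {\<one>}) = ({} :: ('a + 'a) set)")
  case True
  then have "X = {}" "H \<subseteq> {\<one>}" by auto
  then have "X \<union> H \<subseteq> {\<one>}" by auto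
  then have "carrier G \<subseteq> generate G {\<one>}"
    using mono_generate[of "X \<union> H" "{\<one>}"] generates by simp
  then have trivial: "x = \<one>" if "x \<in> carrier G" for x using that by (auto simp: generate_one)
  show ?thesis
  proof (intro exI[of _ 0] ballI)
    fix x y z w assume "x \<in> carrier G" "y \<in> carrier G" "z \<in> carrier G" "w \<in> carrier G"
    then have "x = \<one>" "y = \<one>" "z = \<one>" "w = \<one>" using trivial by auto
    then show "word_dist x z + word_dist y w \<le> max (word_dist x y + word_dist z w) (word_dist y z + word_dist x w) + 2 * 0" by simp
  qed
next
  case False
  then obtain a where a: "a \<in> Inl ` X \<union> Inr ` (H - {\<one>})" by blast
  let ?\<Gamma> = "relative_cayley_graph G H X"
  obtain \<delta> where \<delta>: "\<And>x y z w. x \<in> realization_points ?\<Gamma> \<Longrightarrow> y \<in> realization_points ?\<Gamma> \<Longrightarrow>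
      z \<in> realization_points ?\<Gamma> \<Longrightarrow> w \<in> realization_points ?\<Gamma> \<Longrightarrow>
      gromov_product (realization_dist ?\<Gamma>) w x z \<ge>
        min (gromov_product (realization_dist ?\<Gamma>) w x y) (gromov_product (realization_dist ?\<Gamma>) w y z) - \<delta>"
    using assms unfolding hyperbolic_graph_def gromov_hyperbolic_def by blast
  have pt: "((x, a), 0) \<in> realization_points ?\<Gamma>" if "x \<in> carrier G" for x
    using that a unfolding realization_points_def arcs_relative_cayley_graph by simp
  have "word_dist x z + word_dist y w \<le> max (word_dist x y + word_dist z w) (word_dist y z + word_dist x w) + 2 * nat \<lceil>\<delta>\<rceil>"
    if c: "x \<in> carrier G" "y \<in> carrier G" "z \<in> carrier G" "w \<in> carrier G" for x y z w
  proof -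
    note d = realization_dist_vertices[OF _ _ a]
    have "\<delta> \<le> real (nat \<lceil>\<delta>\<rceil>)" by linarith
    then have "real (word_dist x z) + real (word_dist y w) \<le>
        max (real (word_dist x y) + real (word_dist z w)) (real (word_dist y z) + real (word_dist x w)) + 2 * real (nat \<lceil>\<delta>\<rceil>)"
      using \<delta>[OF pt[OF c(1)] pt[OF c(2)] pt[OF c(3)] pt[OF c(4)]]
      unfolding gromov_product_def d[OF c(1,4)] d[OF c(3,4)] d[OF c(1,3)] d[OF c(2,4)] d[OF c(1,2)] d[OF c(2,3)]
      by (simp add: min_def max_def field_simps split: if_splits)
    then have "real (word_dist x z + word_dist y w) \<le> real (max (word_dist x y + word_dist z w) (word_dist y z + word_dist x w) + 2 * nat \<lceil>\<delta>\<rceil>)"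
      by (simp add: of_nat_max)
    then show ?thesis by (simp only: of_nat_le_iff)
  qed
  then show ?thesis by blast
qed

lemma relative_dist_le:
  assumes "(\<one>, h) \<in> step H ^^ k"
  shows "relative_dist G H X \<one> h \<le> ereal (real k)"
proof -
  let ?\<Gamma> = "relative_cayley_graph G H X"
  let ?\<Gamma>H = "cayley_graph (G\<lparr>carrier := H\<rparr>) ({} <+> (H - {\<one>}))"
  let ?\<Delta> = "?\<Gamma>\<lparr>arcs := arcs ?\<Gamma> - arcs ?\<Gamma>H\<rparr>"
  have arcs: "arcs ?\<Delta> = carrier G \<times> (Inl ` X \<union> Inr ` (H - {\<one>})) - H \<times> Inr ` (H - {\<one>})"
    using arcs_relative_cayley_graph by (simp add: cayley_graph_def Plus_def)
  have joinedI: "(g, g \<otimes> letter a) \<in> joined ?\<Delta>" "(g \<otimes> letter a, g) \<in> joined ?\<Delta>"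
    if "(g, a) \<in> arcs ?\<Delta>" for g a
    unfolding joined_iff by (rule bexI[OF _ that], simp add: relative_cayley_graph_simps)+
  have sub: "step H \<subseteq> joined ?\<Delta>"
  proof (rule subrelI)
    fix u v assume uv: "(u, v) \<in> step H"
    then have c: "u \<in> carrier G" "v \<in> carrier G" by (auto dest: step_closed)
    have "(\<exists>a\<in>X. v = u \<otimes> a \<or> u = v \<otimes> a) \<or>
        (\<exists>a\<in>H - {\<one>}. (v = u \<otimes> a \<and> u \<notin> H) \<or> (u = v \<otimes> a \<and> v \<notin> H))"
      using uv unfolding step_def by auto
    then consider a where "a \<in> X" "v = u \<otimes> a" | a where "a \<in> X" "u = v \<otimes> a"
      | a where "a \<in> H - {\<one>}" "v = u \<otimes> a" "u \<notin> H" | a where "a \<in> H - {\<one>}" "u = v \<otimes> a" "v \<notin> H"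
      by blast
    then show "(u, v) \<in> joined ?\<Delta>"
    proof cases
      case 1
      then have "(u, Inl a) \<in> arcs ?\<Delta>" unfolding arcs using c by auto
      from joinedI(1)[OF this] show ?thesis using 1 by (simp add: letter_def)
    next
      case 2
      then have "(v, Inl a) \<in> arcs ?\<Delta>" unfolding arcs using c by auto
      from joinedI(2)[OF this] show ?thesis using 2 by (simp add: letter_def)
    next
      case 3
      then have "(u, Inr a) \<in> arcs ?\<Delta>" unfolding arcs using c by auto
      from joinedI(1)[OF this] show ?thesis using 3 by (simp add: letter_def)
    next
      case 4
      then have "(v, Inr a) \<in> arcs ?\<Delta>" unfolding arcs using c by auto
      from joinedI(2)[OF this] show ?thesis using 4 by (simp add: letter_def)
    qed
  qed
  have "(\<one>, h) \<in> joined ?\<Delta> ^^ k"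
    using assms relpow_subset[OF sub] by blast
  then have "graph_dist ?\<Delta> \<one> h \<le> ereal (real k)"
    by (rule graph_dist_le) (simp add: relative_cayley_graph_simps)
  then show ?thesis unfolding relative_dist_def Let_def .
qed

end

lemma hyperbolic_pair_if_embedded:
  fixes G (structure)
  assumes "group G" and "subgroup H G" and "X \<subseteq> carrier G" and "hyperbolically_embedded_wrt G H X"
  shows "\<exists>\<delta>. hyperbolic_pair G H X \<delta>"
proof -
  have emb: "generate G (X \<union> H) = carrier G" "hyperbolic_graph (relative_cayley_graph G H X)"
      "\<And>h r. h \<in> H \<Longrightarrow> finite {k \<in> H. relative_dist G H X h k \<le> ereal r}"
    using assms(4) unfolding hyperbolically_embedded_wrt_def by auto
  interpret relative_cayley G H X
    using assms emb(1) by (intro relative_cayley.intro relative_cayley_axioms.intro)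
  have "finite (small n)" for n
  proof (rule finite_subset[OF _ emb(3)[OF H.one_closed, of "real n"]], rule subsetI)
    fix h assume "h \<in> small n"
    then obtain k where k: "h \<in> H" "k \<le> n" "(\<one>, h) \<in> step H ^^ k"
      unfolding small_def reach_def by auto
    then have "relative_dist G H X \<one> h \<le> ereal (real n)"
      using relative_dist_le[OF k(3)] by (meson ereal_less_eq(3) of_nat_le_iff order_trans)
    then show "h \<in> {k \<in> H. relative_dist G H X \<one> k \<le> ereal (real n)}" using k(1) by blast
  qed
  moreover obtain \<delta> where "\<forall>x\<in>carrier G. \<forall>y\<in>carrier G. \<forall>z\<in>carrier G. \<forall>w\<in>carrier G.
      word_dist x z + word_dist y w \<le> max (word_dist x y + word_dist z w) (word_dist y z + word_dist x w) + 2 * \<delta>"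
    using gromov_four_point[OF emb(2)] by blast
  ultimately have "hyperbolic_pair G H X \<delta>"
    by unfold_locales blast+
  then show ?thesis ..
qed

section \<open>Hyperbolically embedded subgroups are undistorted\<close>

theorem corollary1p8:
  fixes G :: "('a, 'b) monoid_scheme" and H :: "'a set"
  assumes "group G"
    and "hyperbolically_embedded G H"
  shows "\<exists>B::real. \<forall>h \<in> derived G H. scl (G\<lparr>carrier := H\<rparr>) h \<le> B * scl G h"
proof -
  obtain X where H: "subgroup H G" and X: "X \<subseteq> carrier G" "hyperbolically_embedded_wrt G H X"
    using assms(2) unfolding hyperbolically_embedded_def by blast
  obtain \<delta> where "hyperbolic_pair G H X \<delta>"
    using hyperbolic_pair_if_embedded[OF assms(1) H X] by blast
  then obtain k A C :: nat where k: "k \<ge> 1"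
    and bound: "\<forall>h\<in>derived G H. cl (G\<lparr>carrier := H\<rparr>) (h [^]\<^bsub>G\<^esub> k) \<le> A * cl G h + C"
    using hyperbolic_pair.cl_power_bound by blast
  have "scl (G\<lparr>carrier := H\<rparr>) h \<le> real A / real k * scl G h" if "h \<in> derived G H" for h
    using group.scl_bound[OF assms(1) H k _ that] bound by blast
  then show ?thesis by blast
qed

end
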